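(* For any positive integer $\delta$, there exists a full-dimensional cone in the secondary fan $\Phi(\Gamma_\delta)$ in which each point corresponds to a smooth tropical surface containing a two-point family of tropical lines; that is, there is a regular lattice subdivision $\mathcal{S}$ of $\Gamma_\delta$ with $K(\mathcal{S})$ full-dimensional in $\mathbb{R}^{\Gamma_\delta\cap\mathbb{Z}^3}$, such that for every $\alpha\in K(\mathcal{S})$ the tropical surface $V_{tr}(f_\alpha)$ is smooth of degree $\delta$ and contains all the tropical lines of some two-point family. In particular, there exist smooth tropical surfaces of degree $\delta$ containing infinitely many tropical lines.
   Context: For a positive integer $\delta$ let $\Gamma_\delta=\operatorname{conv}\{(0,0,0),(\delta,0,0),(0,\delta,0),(0,0,\delta)\}\subset\mathbb{R}^3$ and $\mathcal{A}=\Gamma_\delta\cap\mathbb{Z}^3$. For $\alpha\in\mathbb{R}^{\mathcal{A}}$ (a function $\mathcal{A}\to\mathbb{R}$), projecting the upper (top) faces of $\operatorname{conv}\{(a,\alpha(a)):a\in\mathcal{A}\}\subset\mathbb{R}^4$ to $\mathbb{R}^3$ gives a lattice subdivision $\mathcal{S}_\alpha$ of $\Gamma_\delta$; subdivisions arising this way are called regular. For a regular subdivision $\mathcal{S}$, $K(\mathcal{S})=\{\alpha\in\mathbb{R}^{\mathcal{A}}:\mathcal{S}_\alpha=\mathcal{S}\}$; the cones $K(\mathcal{S})$ form the secondary fan $\Phi(\Gamma_\delta)$ in $\mathbb{R}^{\mathcal{A}}$. For $\alpha\in\mathbb{R}^{\mathcal{A}}$ let $f_\alpha(x)=\max_{a\in\mathcal{A}}\{\alpha(a)+\langle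 a,x\rangle\}$, and let $V_{tr}(f_\alpha)\subset\mathbb{R}^3$ be the set of points where this maximum is attained at least twice. This is a tropical surface of degree $\delta$ with dual subdivision $\mathcal{S}_\alpha$; it is smooth if $\mathcal{S}_\alpha$ is an elementary (unimodular) triangulation, i.e. all its maximal elements are lattice tetrahedra of volume $\frac16$. Tropical lines in $\mathbb{R}^3$: put $\omega_1=-e_1$, $\omega_2=-e_2$, $\omega_3=-e_3$, $\omega_4=e_1+e_2+e_3$. A tropical line is a set consisting, for some partition $\{1,2,3,4\}=\{i,j\}\sqcup\{k,l\}$, some $v_1\in\mathbb{R}^3$ and some $s\ge0$, with $v_2=v_1+s(\omega_k+\omega_l)$, of the segment $[v_1,v_2]$, the two unbounded rays from $v_1$ in directions $\omega_i,\omega_j$, and the two unbounded rays from $v_2$ in directions $\omega_k,\omega_l$. A two-point family is an infinite collection of tropical lines in $\mathbb{R}^3$ such that there exist two distinct points lying on all tropical lines of the collection. *)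

theory Defs
  imports "HOL-Analysis.Analysis" "HOL-Library.Function_Algebras"
begin

text \<open>Pointwise real vector space structure on functions, so that \<^const>\<open>dim\<close> applies to
  sets of functions.\<close>

instantiation "fun" :: (type, real_vector) real_vector
begin

definition scaleR_fun :: "real \<Rightarrow> ('a \<Rightarrow> 'b) \<Rightarrow> 'a \<Rightarrow> 'b" where
  "scaleR_fun c f = (\<lambda>x. c *\<^sub>R f x)"

instance
  by standard (simp_all add: scaleR_fun_def fun_eq_iff scaleR_add_right scaleR_add_left)

end

definition lattice :: "(real^3) set" where
  "lattice = {a. \<forall>i. a $ i \<in> \<int>}"

definition Gamma_simplex :: "nat \<Rightarrow> (real^3) set" where
  "Gamma_simplex \<delta> = convex hull {0, axis 1 (real \<delta>), axis 2 (real \<delta>), axis 3 (real \<delta>)}"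

definition lattice_points :: "nat \<Rightarrow> (real^3) set" where
  "lattice_points \<delta> = Gamma_simplex \<delta> \<inter> lattice"

text \<open>A function on the lattice points of \<open>\<Gamma>\<^sub>\<delta>\<close> is represented by its extension by zero to all of
  \<open>\<real>\<^sup>3\<close>, so that the set below is a vector space of dimension \<open>card (lattice_points \<delta>)\<close>.\<close>

definition coefficient_space :: "nat \<Rightarrow> (real^3 \<Rightarrow> real) set" where
  "coefficient_space \<delta> = {\<alpha>. \<forall>a. a \<notin> lattice_points \<delta> \<longrightarrow> \<alpha> a = 0}"

definition lifted_polytope :: "nat \<Rightarrow> (real^3 \<Rightarrow> real) \<Rightarrow> ((real^3) \<times> real) set" where
  "lifted_polytope \<delta> \<alpha> = convex hull ((\<lambda>a. (a, \<alpha> a)) ` lattice_points \<delta>)"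

text \<open>The upper faces are the faces having an outer normal vector with positive last
  coordinate.  Faces of every dimension are included; the polytope itself is an upper face if it
  lies in a non-vertical hyperplane.\<close>

definition upper_face :: "((real^3) \<times> real) set \<Rightarrow> ((real^3) \<times> real) set \<Rightarrow> bool" where
  "upper_face P F \<longleftrightarrow>
     (\<exists>u t. t > 0 \<and> F = {p \<in> P. \<forall>q \<in> P. (u, t) \<bullet> q \<le> (u, t) \<bullet> p})"

definition induced_subdivision :: "nat \<Rightarrow> (real^3 \<Rightarrow> real) \<Rightarrow> (real^3) set set" where
  "induced_subdivision \<delta> \<alpha> = {fst ` F | F. upper_face (lifted_polytope \<delta> \<alpha>) F}"

definition regular_subdivision :: "nat \<Rightarrow> (real^3) set set \<Rightarrow> bool" where
  "regular_subdivision \<delta> S \<longleftrightarrow> (\<exists>\<alpha> \<in> coefficient_space \<delta>. S = induced_subdivision \<delta> \<alpha>)"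

definition secondary_cone :: "nat \<Rightarrow> (real^3) set set \<Rightarrow> (real^3 \<Rightarrow> real) set" where
  "secondary_cone \<delta> S = {\<alpha> \<in> coefficient_space \<delta>. induced_subdivision \<delta> \<alpha> = S}"

definition secondary_fan :: "nat \<Rightarrow> (real^3 \<Rightarrow> real) set set" where
  "secondary_fan \<delta> = {secondary_cone \<delta> S | S. regular_subdivision \<delta> S}"

text \<open>The dimension of a cone is the dimension of its linear span, which is what \<^const>\<open>dim\<close>
  computes.\<close>

definition full_dimensional :: "nat \<Rightarrow> (real^3 \<Rightarrow> real) set \<Rightarrow> bool" where
  "full_dimensional \<delta> K \<longleftrightarrow> dim K = card (lattice_points \<delta>)"

definition lattice_tetrahedron :: "(real^3) set \<Rightarrow> bool" where
  "lattice_tetrahedron T \<longleftrightarrow>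
     (\<exists>C. C \<subseteq> lattice \<and> card C = 4 \<and> \<not> affine_dependent C \<and> T = convex hull C)"

text \<open>This predicate is meant for a subdivision \<open>S\<close> and does not itself require \<open>S\<close> to be one.\<close>

definition elementary_triangulation :: "(real^3) set set \<Rightarrow> bool" where
  "elementary_triangulation S \<longleftrightarrow>
     (\<forall>T \<in> S. (\<forall>T' \<in> S. \<not> T \<subset> T') \<longrightarrow> lattice_tetrahedron T \<and> measure lebesgue T = 1/6)"

definition tropical_polynomial :: "nat \<Rightarrow> (real^3 \<Rightarrow> real) \<Rightarrow> real^3 \<Rightarrow> real" where
  "tropical_polynomial \<delta> \<alpha> x = Max ((\<lambda>a. \<alpha> a + a \<bullet> x) ` lattice_points \<delta>)"

definition tropical_surface :: "nat \<Rightarrow> (real^3 \<Rightarrow> real) \<Rightarrow> (real^3) set" where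
  "tropical_surface \<delta> \<alpha> =
     {x. \<exists>a \<in> lattice_points \<delta>. \<exists>b \<in> lattice_points \<delta>. a \<noteq> b \<and>
           \<alpha> a + a \<bullet> x = tropical_polynomial \<delta> \<alpha> x \<and>
           \<alpha> b + b \<bullet> x = tropical_polynomial \<delta> \<alpha> x}"

definition smooth_surface :: "nat \<Rightarrow> (real^3 \<Rightarrow> real) \<Rightarrow> bool" where
  "smooth_surface \<delta> \<alpha> \<longleftrightarrow>
     \<alpha> \<in> coefficient_space \<delta> \<and> elementary_triangulation (induced_subdivision \<delta> \<alpha>)"

text \<open>Only the values at the indices 1, 2, 3, 4 are used.\<close>

definition omega :: "nat \<Rightarrow> real^3" where
  "omega i = (if i = 1 then - axis 1 1
              else if i = 2 then - axis 2 1
              else if i = 3 then - axis 3 1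
              else axis 1 1 + axis 2 1 + axis 3 1)"

definition ray :: "real^3 \<Rightarrow> real^3 \<Rightarrow> (real^3) set" where
  "ray v w = {v + t *\<^sub>R w | t. t \<ge> 0}"

definition tropical_line :: "(real^3) set \<Rightarrow> bool" where
  "tropical_line L \<longleftrightarrow>
     (\<exists>i j k l v1 v2 s. {i, j, k, l} = {1, 2, 3, 4} \<and> s \<ge> 0 \<and>
        v2 = v1 + s *\<^sub>R (omega k + omega l) \<and>
        L = closed_segment v1 v2 \<union> ray v1 (omega i) \<union> ray v1 (omega j)
              \<union> ray v2 (omega k) \<union> ray v2 (omega l))"

definition two_point_family :: "(real^3) set set \<Rightarrow> bool" where
  "two_point_family \<L> \<longleftrightarrow>
     infinite \<L> \<and> (\<forall>L \<in> \<L>. tropical_line L) \<and>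
     (\<exists>p q. p \<noteq> q \<and> (\<forall>L \<in> \<L>. p \<in> L \<and> q \<in> L))"

end

theory Submission
  imports Defs
begin

text \<open>Suppose that the four monomials \<open>A = (0,0,0)\<close>, \<open>B = (0,0,1)\<close>, \<open>C = (1,\<delta>-1,0)\<close>, \<open>D = (0,1,\<delta>-1)\<close>
  attain the maximum in \<open>f\<^sub>\<alpha>\<close> simultaneously at \<open>v\<close>.  Moving from \<open>v\<close> against the first two coordinates
  keeps \<open>A\<close> and \<open>B\<close> maximal, moving along \<open>\<omega>\<^sub>3\<close> keeps \<open>A\<close> and \<open>C\<close>, moving along \<open>\<omega>\<^sub>4\<close> keeps \<open>C\<close> and \<open>D\<close>.
  Hence all tropical lines with \<open>v\<^sub>2 = v\<close> and \<open>v\<^sub>1 = v + s (\<omega>\<^sub>1 + \<omega>\<^sub>2)\<close>, \<open>s \<ge> 0\<close>, lie on the surface, and they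
  share the ray from \<open>v\<close> along \<open>\<omega>\<^sub>3\<close>.  So it suffices to find a regular unimodular triangulation having
  \<open>ABCD\<close> as a cell.  It is obtained by lifting dimension by dimension: the interval \<open>[0,\<delta>]\<close> is cut into
  unit segments, and over each unimodular simplex the columns of lattice points are climbed one after
  the other in decreasing lexicographic order, which yields a staircase triangulation.  The resulting
  cone is full-dimensional because a finite list of simplices that covers the polytope and is strictly
  supported by \<open>\<alpha>\<close> determines the subdivision, and strict support survives small perturbations.\<close>

section \<open>Subdivisions from supported cells\<close>

text \<open>For \<open>A = lattice_points n\<close> these are the monomials attaining
  \<open>tropical_polynomial\<close> at \<open>u\<close>; the same \<open>u\<close> is a normal
  direction of the lifted polytope.\<close>

definition maximizers :: "'a::euclidean_space set \<Rightarrow> ('a \<Rightarrow> real) \<Rightarrow> 'a \<Rightarrow> 'a set" where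
  "maximizers A \<alpha> u = {a \<in> A. \<forall>b \<in> A. \<alpha> b + b \<bullet> u \<le> \<alpha> a + a \<bullet> u}"

text \<open>For nonempty \<open>T\<close> this means \<open>T = maximizers A \<alpha> u\<close> for
  some \<open>u\<close>. The strict gap is what survives perturbation.\<close>

definition supported_cell :: "'a::euclidean_space set \<Rightarrow> ('a \<Rightarrow> real) \<Rightarrow> 'a set \<Rightarrow> bool" where
  "supported_cell A \<alpha> T \<longleftrightarrow>
     T \<subseteq> A \<and> (\<exists>u c. (\<forall>a \<in> T. \<alpha> a + a \<bullet> u = c) \<and> (\<forall>a \<in> A - T. \<alpha> a + a \<bullet> u < c))"

lemma maximizers_nonempty:
  assumes "finite A" "A \<noteq> {}"
  shows "maximizers A \<alpha> u \<noteq> {}"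
proof -
  have "Max ((\<lambda>a. \<alpha> a + a \<bullet> u) ` A) \<in> (\<lambda>a. \<alpha> a + a \<bullet> u) ` A"
    using assms by (intro Max_in) auto
  then obtain a where "a \<in> A" "\<alpha> a + a \<bullet> u = Max ((\<lambda>a. \<alpha> a + a \<bullet> u) ` A)"
    by auto
  then have "a \<in> maximizers A \<alpha> u"
    using assms by (auto simp: maximizers_def)
  then show ?thesis by blast
qed

text \<open>A face of the hull of a finite set is the hull of a subset, whose points all maximize
  the functional. Upper faces can thus be read off from the lifted lattice points.\<close>

lemma exposed_face_convex_hull:
  fixes w :: "'a::euclidean_space"
  assumes "finite X"
  shows "{p \<in> convex hull X. \<forall>q \<in> convex hull X. w \<bullet> q \<le> w \<bullet> p}
       = convex hull {x \<in> X. \<forall>y \<in> X. w \<bullet> y \<le> w \<bullet> x}" (is "?F = convex hull ?M")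
proof (cases "X = {}")
  case False
  obtain x0 where x0: "x0 \<in> X" "\<forall>y \<in> X. w \<bullet> y \<le> w \<bullet> x0"
  proof -
    have "Max ((\<lambda>x. w \<bullet> x) ` X) \<in> (\<lambda>x. w \<bullet> x) ` X"
      using assms False by (intro Max_in) auto
    then obtain x where "x \<in> X" "w \<bullet> x = Max ((\<lambda>x. w \<bullet> x) ` X)" by auto
    then show ?thesis using that[of x] assms by auto
  qed
  define m where "m = w \<bullet> x0"
  have "convex hull X \<subseteq> {p. w \<bullet> p \<le> m}"
    using x0 by (intro hull_minimal) (auto simp: m_def convex_halfspace_le)
  then have le: "w \<bullet> p \<le> m" if "p \<in> convex hull X" for p
    using that by auto
  have x0': "x0 \<in> convex hull X" using x0 by (simp add: hull_inc)
  have F: "?F = convex hull X \<inter> {p. w \<bullet> p = m}"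
    using le x0' by (force simp: m_def)
  have M: "?M = X \<inter> {p. w \<bullet> p = m}"
    using x0 by (force simp: m_def)
  have face: "?F face_of convex hull X"
    unfolding F by (rule face_of_Int_supporting_hyperplane_le[OF convex_convex_hull le])
  obtain S' where S': "S' \<subseteq> X" "?F = convex hull S'"
    by (rule face_of_convex_hull_subset[OF finite_imp_compact[OF assms] face])
  have "S' \<subseteq> ?M"
  proof
    fix x assume "x \<in> S'"
    then have "x \<in> ?F" unfolding S'(2) by (rule hull_inc)
    then show "x \<in> ?M" using S'(1) \<open>x \<in> S'\<close> F M by blast
  qed
  then have "?F \<subseteq> convex hull ?M"
    unfolding S'(2) by (rule hull_mono)
  moreover have "convex hull ?M \<subseteq> ?F"
    unfolding F M
    by (intro hull_minimal convex_Int convex_convex_hull convex_hyperplane) (auto simp: hull_inc)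
  ultimately show ?thesis by blast
qed auto

text \<open>Scaling an upper normal to \<open>(u, 1)\<close> makes its value at a lifted point
  \<open>\<alpha> a + a \<bullet> u\<close>. Cells are thereby indexed by points \<open>u\<close>:
  the duality with the tropical surface.\<close>

lemma induced_subdivision_eq_range:
  assumes fin: "finite (lattice_points n)"
  shows "induced_subdivision n \<alpha> = range (\<lambda>u. convex hull (maximizers (lattice_points n) \<alpha> u))"
proof -
  let ?A = "lattice_points n"
  let ?X = "(\<lambda>a. (a, \<alpha> a)) ` ?A"
  have fst_face: "fst ` {p \<in> lifted_polytope n \<alpha>. \<forall>q \<in> lifted_polytope n \<alpha>. (u, t) \<bullet> q \<le> (u, t) \<bullet> p}
      = convex hull (maximizers ?A \<alpha> ((1/t) *\<^sub>R u))" if "t > 0" for u t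
  proof -
    have "\<alpha> a + a \<bullet> (1/t) *\<^sub>R u = ((u, t) \<bullet> (a, \<alpha> a)) / t" for a
      using that by (simp add: field_simps inner_commute)
    then have "\<alpha> b + b \<bullet> (1/t) *\<^sub>R u \<le> \<alpha> a + a \<bullet> (1/t) *\<^sub>R u
        \<longleftrightarrow> (u, t) \<bullet> (b, \<alpha> b) \<le> (u, t) \<bullet> (a, \<alpha> a)" for a b
      using that by (simp add: divide_le_cancel)
    then have "{x \<in> ?X. \<forall>y \<in> ?X. (u, t) \<bullet> y \<le> (u, t) \<bullet> x}
        = (\<lambda>a. (a, \<alpha> a)) ` maximizers ?A \<alpha> ((1/t) *\<^sub>R u)"
      by (auto simp: maximizers_def)
    then have "{p \<in> lifted_polytope n \<alpha>. \<forall>q \<in> lifted_polytope n \<alpha>. (u, t) \<bullet> q \<le> (u, t) \<bullet> p}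
        = convex hull ((\<lambda>a. (a, \<alpha> a)) ` maximizers ?A \<alpha> ((1/t) *\<^sub>R u))"
      unfolding lifted_polytope_def using exposed_face_convex_hull[of ?X "(u, t)"] fin by simp
    then show ?thesis
      by (simp add: convex_hull_linear_image[OF linear_fst] image_image)
  qed
  show ?thesis
  proof (intro equalityI subsetI)
    fix Y assume "Y \<in> induced_subdivision n \<alpha>"
    then show "Y \<in> range (\<lambda>u. convex hull (maximizers ?A \<alpha> u))"
      unfolding induced_subdivision_def upper_face_def using fst_face by blast
  next
    fix Y assume "Y \<in> range (\<lambda>u. convex hull (maximizers ?A \<alpha> u))"
    then obtain u where "Y = convex hull (maximizers ?A \<alpha> u)" by auto
    then have "Y = fst ` {p \<in> lifted_polytope n \<alpha>.
        \<forall>q \<in> lifted_polytope n \<alpha>. (u, 1) \<bullet> q \<le> (u, 1) \<bullet> p}"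
      using fst_face[of 1 u] by simp
    moreover have "upper_face (lifted_polytope n \<alpha>) {p \<in> lifted_polytope n \<alpha>.
        \<forall>q \<in> lifted_polytope n \<alpha>. (u, 1) \<bullet> q \<le> (u, 1) \<bullet> p}"
      unfolding upper_face_def using zero_less_one by blast
    ultimately show "Y \<in> induced_subdivision n \<alpha>"
      unfolding induced_subdivision_def by blast
  qed
qed

text \<open>Compare the supporting function of the maximizers with that of a cell containing their
  barycentre: their difference is affine, nonnegative on the cell and nonpositive on the
  maximizers.\<close>

lemma maximizers_subset_cell:
  assumes fin: "finite A" and "A \<noteq> {}"
    and supp: "\<And>T. T \<in> \<T> \<Longrightarrow> supported_cell A \<alpha> T"
    and cover: "convex hull A \<subseteq> (\<Union>T \<in> \<T>. convex hull T)"
  shows "\<exists>T \<in> \<T>. maximizers A \<alpha> u \<subseteq> T"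
proof -
  define M where "M = maximizers A \<alpha> u"
  have M: "M \<noteq> {}" "M \<subseteq> A" "finite M"
    using maximizers_nonempty[OF assms(1,2)] fin
    by (auto simp: M_def maximizers_def intro: finite_subset)
  define p where "p = (\<Sum>m \<in> M. (1 / card M) *\<^sub>R m)"
  have "p \<in> convex hull M"
    unfolding p_def using M by (intro convex_sum) (auto simp: hull_inc)
  then have "p \<in> convex hull A" using M(2) hull_mono by blast
  then obtain T where T: "T \<in> \<T>" "p \<in> convex hull T" using cover by blast
  obtain v c where v: "\<And>a. a \<in> T \<Longrightarrow> \<alpha> a + a \<bullet> v = c" "\<And>a. a \<in> A - T \<Longrightarrow> \<alpha> a + a \<bullet> v < c"
    and TA: "T \<subseteq> A"
    using supp[OF T(1)] unfolding supported_cell_def by blast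
  obtain m0 where m0: "m0 \<in> M" using M by auto
  define d where "d = \<alpha> m0 + m0 \<bullet> u"
  have uM: "\<alpha> m + m \<bullet> u = d" if "m \<in> M" for m
    using that m0 unfolding M_def maximizers_def d_def by (auto intro: antisym)
  have uA: "\<alpha> a + a \<bullet> u \<le> d" if "a \<in> A" for a
    using that m0 unfolding M_def maximizers_def d_def by auto
  have q: "(v - u) \<bullet> x = x \<bullet> v - x \<bullet> u" for x
    by (metis inner_commute inner_diff_right)
  have "(v - u) \<bullet> a \<ge> c - d" if "a \<in> T" for a
    using v(1)[OF that] uA[of a] subsetD[OF TA that] by (simp add: q)
  then have "convex hull T \<subseteq> {x. (v - u) \<bullet> x \<ge> c - d}"
    by (intro hull_minimal convex_halfspace_ge) auto
  then have p_ge: "(v - u) \<bullet> p \<ge> c - d" using T(2) by auto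
  have M_less: "(v - u) \<bullet> m < c - d" if "m \<in> M" "m \<notin> T" for m
    using v(2)[of m] uM[OF that(1)] M(2) that by (auto simp: q)
  have M_le: "(v - u) \<bullet> m \<le> c - d" if "m \<in> M" for m
    using v(1)[of m] uM[OF that] M_less[OF that]
    by (cases "m \<in> T") (auto simp: q)
  have "M \<subseteq> T"
  proof (rule ccontr)
    assume "\<not> M \<subseteq> T"
    then obtain m where m: "m \<in> M" "m \<notin> T" by auto
    \<comment> \<open>Every maximizer has positive weight in \<open>p\<close>, so a single one
      outside \<open>T\<close> pulls the average strictly below \<open>c - d\<close>.\<close>
    have "(\<Sum>m \<in> M. (v - u) \<bullet> m) < (\<Sum>m \<in> M. c - d)"
      using M(3) M_le M_less m by (intro sum_strict_mono_ex1) auto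
    moreover have "card M > 0" using M by (simp add: card_gt_0_iff)
    moreover have "(v - u) \<bullet> p = (\<Sum>m \<in> M. (v - u) \<bullet> m) / card M"
      by (simp add: p_def inner_sum_right sum_divide_distrib)
    ultimately have "(v - u) \<bullet> p < c - d" by (simp add: pos_divide_less_eq mult.commute)
    then show False using p_ge by simp
  qed
  then show ?thesis using T(1) M_def by auto
qed

text \<open>Differences from a base point are linearly independent, so a linear functional can take
  any prescribed values on them.\<close>

lemma affine_interpolation:
  fixes T :: "'a::euclidean_space set"
  assumes "\<not> affine_dependent T"
  shows "\<exists>w k. \<forall>a \<in> T. a \<bullet> w = k + g a"
proof (cases "T = {}")
  case False
  then obtain a0 where a0: "a0 \<in> T" by auto
  let ?S = "(\<lambda>x. x - a0) ` (T - {a0})"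
  have "independent ((\<lambda>x. - a0 + x) ` (T - {a0}))"
    using affine_dependent_iff_dependent2[OF a0] assms by simp
  then have "independent ?S" by simp
  from linear_independent_extend[OF this, of "\<lambda>y. g (y + a0) - g a0"]
  obtain f :: "'a \<Rightarrow> real" where f: "linear f" "\<forall>y \<in> ?S. f y = g (y + a0) - g a0" by blast
  define w where "w = adjoint f 1"
  have w: "f x = x \<bullet> w" for x
    using adjoint_works[OF f(1), of x 1] by (simp add: w_def)
  have "a \<bullet> w = (a0 \<bullet> w - g a0) + g a" if "a \<in> T" for a
  proof (cases "a = a0")
    case False
    then have "f (a - a0) = g a - g a0" using f(2) that by auto
    then show ?thesis by (simp add: w inner_diff_left)
  qed simp
  then show ?thesis by blast
qed simp

text \<open>With \<open>g = 0\<close> this keeps \<open>T\<close> supported under a change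
  \<open>\<phi>\<close> of the heights; with \<open>\<phi> = 0\<close> a suitable \<open>g\<close>
  singles out a face of \<open>T\<close>.\<close>

lemma supported_cell_perturb:
  fixes A :: "'a::euclidean_space set"
  assumes fin: "finite A" and T: "supported_cell A \<alpha> T" "\<not> affine_dependent T"
  shows "\<forall>\<^sub>F \<epsilon> in at_right 0. \<exists>u c. (\<forall>a \<in> T. \<alpha> a + \<epsilon> * \<phi> a + a \<bullet> u = c + \<epsilon> * g a) \<and>
           (\<forall>a \<in> A - T. \<alpha> a + \<epsilon> * \<phi> a + a \<bullet> u < c)"
proof -
  obtain u c where u: "\<And>a. a \<in> T \<Longrightarrow> \<alpha> a + a \<bullet> u = c" "\<And>a. a \<in> A - T \<Longrightarrow> \<alpha> a + a \<bullet> u < c"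
    using T(1) unfolding supported_cell_def by blast
  \<comment> \<open>Tilting by \<open>\<epsilon> *\<^sub>R w\<close> replaces \<open>\<phi>\<close>
    by \<open>g\<close> on \<open>T\<close>, up to a constant \<open>\<epsilon> * k\<close> that is
    absorbed into \<open>c\<close>.\<close>
  obtain w k where w: "\<And>a. a \<in> T \<Longrightarrow> a \<bullet> w = k + (g a - \<phi> a)"
    using affine_interpolation[OF T(2), of "\<lambda>a. g a - \<phi> a"] by blast
  have "\<forall>\<^sub>F \<epsilon> in at_right 0. \<alpha> a + \<epsilon> * \<phi> a + a \<bullet> (u + \<epsilon> *\<^sub>R w) < c + \<epsilon> * k" if "a \<in> A - T" for a
  proof -
    have "((\<lambda>\<epsilon>. \<alpha> a + \<epsilon> * \<phi> a + a \<bullet> (u + \<epsilon> *\<^sub>R w) - \<epsilon> * k) \<longlongrightarrow>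
        \<alpha> a + 0 * \<phi> a + a \<bullet> (u + 0 *\<^sub>R w) - 0 * k) (at_right 0)"
      by (intro tendsto_intros)
    then have "\<forall>\<^sub>F \<epsilon> in at_right 0. \<alpha> a + \<epsilon> * \<phi> a + a \<bullet> (u + \<epsilon> *\<^sub>R w) - \<epsilon> * k < c"
      using u(2)[OF that] by (intro order_tendstoD(2)) auto
    then show ?thesis by eventually_elim simp
  qed
  then have "\<forall>\<^sub>F \<epsilon> in at_right 0. \<forall>a \<in> A - T. \<alpha> a + \<epsilon> * \<phi> a + a \<bullet> (u + \<epsilon> *\<^sub>R w) < c + \<epsilon> * k"
    using fin by (intro eventually_ball_finite) auto
  then show ?thesis
  proof eventually_elim
    case (elim \<epsilon>)
    have "\<alpha> a + \<epsilon> * \<phi> a + a \<bullet> (u + \<epsilon> *\<^sub>R w) = (c + \<epsilon> * k) + \<epsilon> * g a" if "a \<in> T" for a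
    proof -
      have "\<epsilon> * (a \<bullet> w) = \<epsilon> * (k + (g a - \<phi> a))" using w[OF that] by simp
      then show ?thesis using u(1)[OF that] by (simp add: inner_add_right algebra_simps)
    qed
    with elim show ?case by blast
  qed
qed

lemma supported_cell_face:
  fixes A :: "'a::euclidean_space set"
  assumes fin: "finite A" and T: "supported_cell A \<alpha> T" "\<not> affine_dependent T"
    and C: "C \<subseteq> T" "C \<noteq> {}"
  shows "\<exists>u. maximizers A \<alpha> u = C"
proof -
  \<comment> \<open>The heights stay fixed; the tilt lowers the vertices of \<open>T\<close> outside
    \<open>C\<close> by \<open>\<epsilon>\<close>, so exactly \<open>C\<close> remains
    maximal.\<close>
  have "\<forall>\<^sub>F \<epsilon> in at_right 0. \<exists>u c. (\<forall>a \<in> T. \<alpha> a + \<epsilon> * 0 + a \<bullet> u = c + \<epsilon> * (if a \<in> C then 0 else -1)) \<and>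
           (\<forall>a \<in> A - T. \<alpha> a + \<epsilon> * 0 + a \<bullet> u < c)"
    by (rule supported_cell_perturb[OF fin T])
  moreover have "\<forall>\<^sub>F \<epsilon>::real in at_right 0. \<epsilon> > 0"
    by (rule eventually_at_right_less)
  ultimately have "\<forall>\<^sub>F \<epsilon> in at_right (0::real). \<exists>u. maximizers A \<alpha> u = C"
  proof eventually_elim
    case (elim \<epsilon>)
    then obtain u c where u: "\<And>a. a \<in> T \<Longrightarrow> \<alpha> a + a \<bullet> u = c + \<epsilon> * (if a \<in> C then 0 else -1)"
      "\<And>a. a \<in> A - T \<Longrightarrow> \<alpha> a + a \<bullet> u < c" by auto
    have TA: "T \<subseteq> A" using T by (simp add: supported_cell_def)
    have eq: "\<alpha> a + a \<bullet> u = c" if "a \<in> C" for a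
      using u(1)[of a] that C by auto
    have less: "\<alpha> a + a \<bullet> u < c" if "a \<in> A - C" for a
      using u[of a] that elim by (cases "a \<in> T") auto
    have "maximizers A \<alpha> u = C"
    proof (intro equalityI subsetI)
      fix a assume a: "a \<in> maximizers A \<alpha> u"
      obtain b where "b \<in> C" using C by auto
      then have "c \<le> \<alpha> a + a \<bullet> u" using a eq[of b] C TA by (auto simp: maximizers_def)
      then show "a \<in> C" using less[of a] a by (force simp: maximizers_def)
    next
      fix a assume a: "a \<in> C"
      have "\<alpha> b + b \<bullet> u \<le> c" if "b \<in> A" for b
        using eq[of b] less[of b] that by (cases "b \<in> C") auto
      then show "a \<in> maximizers A \<alpha> u"
        using a eq[OF a] C TA by (auto simp: maximizers_def)
    qed
    then show ?case by blast
  qed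
  then show ?thesis
    using eventually_happens'[OF trivial_limit_at_right_real] by blast
qed

text \<open>Covering puts every set of maximizers inside a cell, and support exposes every face of a
  cell. The right-hand side is free of \<open>\<alpha>\<close>, so all heights supporting the same
  cells induce the same subdivision.\<close>

lemma induced_subdivision_eq_faces:
  assumes fin: "finite (lattice_points n)" "lattice_points n \<noteq> {}"
    and supp: "\<And>T. T \<in> \<T> \<Longrightarrow> supported_cell (lattice_points n) \<alpha> T"
    and indep: "\<And>T. T \<in> \<T> \<Longrightarrow> \<not> affine_dependent T"
    and cover: "convex hull (lattice_points n) \<subseteq> (\<Union>T \<in> \<T>. convex hull T)"
  shows "induced_subdivision n \<alpha> = {convex hull C | C. C \<noteq> {} \<and> (\<exists>T \<in> \<T>. C \<subseteq> T)}"
proof (intro equalityI subsetI)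
  fix Y assume "Y \<in> induced_subdivision n \<alpha>"
  then obtain u where "Y = convex hull (maximizers (lattice_points n) \<alpha> u)"
    by (auto simp: induced_subdivision_eq_range[OF fin(1)])
  then show "Y \<in> {convex hull C | C. C \<noteq> {} \<and> (\<exists>T \<in> \<T>. C \<subseteq> T)}"
    using maximizers_subset_cell[OF fin supp cover, of u] maximizers_nonempty[OF fin, of \<alpha> u]
    by blast
next
  fix Y assume "Y \<in> {convex hull C | C. C \<noteq> {} \<and> (\<exists>T \<in> \<T>. C \<subseteq> T)}"
  then obtain C T where "Y = convex hull C" "C \<noteq> {}" "T \<in> \<T>" "C \<subseteq> T" by blast
  then show "Y \<in> induced_subdivision n \<alpha>"
    using supported_cell_face[OF fin(1) supp indep, of T C]
    by (auto simp: induced_subdivision_eq_range[OF fin(1)])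
qed

text \<open>Vertices of a simplex are extreme points, and extreme points of a hull lie in every
  generating set. Equality of cells thus recovers maximal monomials.\<close>

lemma convex_hull_affine_independent_subset_maximizers:
  fixes T :: "'a::euclidean_space set"
  assumes "\<not> affine_dependent T" "convex hull T = convex hull (maximizers A \<alpha> u)"
  shows "T \<subseteq> maximizers A \<alpha> u"
  using assms extreme_point_of_convex_hull extreme_point_of_convex_hull_affine_independent
  by (metis subsetI)

text \<open>All cells stay supported when a single height is changed slightly, so the span of the cone
  contains every coordinate direction.\<close>

lemma full_dimensional_secondary_cone:
  assumes fin: "finite (lattice_points n)" "lattice_points n \<noteq> {}"
    and finT: "finite \<T>"
    and supp: "\<And>T. T \<in> \<T> \<Longrightarrow> supported_cell (lattice_points n) \<alpha> T"
    and indep: "\<And>T. T \<in> \<T> \<Longrightarrow> \<not> affine_dependent T"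
    and cover: "convex hull (lattice_points n) \<subseteq> (\<Union>T \<in> \<T>. convex hull T)"
    and \<alpha>: "\<alpha> \<in> coefficient_space n"
  shows "full_dimensional n (secondary_cone n (induced_subdivision n \<alpha>))"
proof -
  let ?A = "lattice_points n"
  let ?K = "secondary_cone n (induced_subdivision n \<alpha>)"
  define e :: "real^3 \<Rightarrow> real^3 \<Rightarrow> real" where "e b = (\<lambda>a. if a = b then 1 else 0)" for b
  have \<alpha>K: "\<alpha> \<in> ?K" using \<alpha> by (simp add: secondary_cone_def)
  have sum_e: "(\<Sum>b \<in> ?A. x b *\<^sub>R e b) = (\<lambda>a. if a \<in> ?A then x a else 0)" for x :: "real^3 \<Rightarrow> real"
  proof
    fix a
    have "(\<Sum>b \<in> B. x b *\<^sub>R e b) a = (\<Sum>b \<in> B. if a = b then x b else 0)" if "finite B" for B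
      using that by (induction B) (auto simp: scaleR_fun_def e_def)
    then show "(\<Sum>b \<in> ?A. x b *\<^sub>R e b) a = (if a \<in> ?A then x a else 0)"
      using fin(1) by (simp add: sum.delta)
  qed
  have inj: "inj_on e ?A"
    by (auto simp: inj_on_def e_def fun_eq_iff)
  have ind: "independent (e ` ?A)"
  proof
    assume "dependent (e ` ?A)"
    then obtain c v where 0: "(\<Sum>v \<in> e ` ?A. c v *\<^sub>R v) = 0" and "v \<in> e ` ?A" and v: "c v \<noteq> 0"
      using fin(1) by (auto simp: real_vector.dependent_finite)
    then obtain b where b: "b \<in> ?A" "v = e b" by auto
    have "(\<Sum>b \<in> ?A. c (e b) *\<^sub>R e b) = 0"
      using 0 by (simp add: sum.reindex[OF inj])
    then have "(\<lambda>a. if a \<in> ?A then c (e a) else 0) = 0"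
      by (simp add: sum_e[of "\<lambda>b. c (e b)"])
    from fun_cong[OF this, of b] b v show False by simp
  qed
  have e_span: "e b \<in> span ?K" if b: "b \<in> ?A" for b
  proof -
    have "\<forall>\<^sub>F \<epsilon> in at_right (0::real). \<forall>T \<in> \<T>. \<exists>u c.
        (\<forall>a \<in> T. \<alpha> a + \<epsilon> * e b a + a \<bullet> u = c + \<epsilon> * 0) \<and>
        (\<forall>a \<in> ?A - T. \<alpha> a + \<epsilon> * e b a + a \<bullet> u < c)"
      using finT by (intro eventually_ball_finite ballI supported_cell_perturb[OF fin(1) supp indep])
    moreover have "\<forall>\<^sub>F \<epsilon>::real in at_right 0. \<epsilon> > 0"
      by (rule eventually_at_right_less)
    ultimately have "\<forall>\<^sub>F \<epsilon> in at_right (0::real). e b \<in> span ?K"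
    proof eventually_elim
      case (elim \<epsilon>)
      let ?\<beta> = "\<alpha> + \<epsilon> *\<^sub>R e b"
      have "supported_cell ?A ?\<beta> T" if "T \<in> \<T>" for T
        using elim(1) supp[OF that] that by (simp add: supported_cell_def scaleR_fun_def)
      then have "induced_subdivision n ?\<beta> = induced_subdivision n \<alpha>"
        using induced_subdivision_eq_faces[OF fin supp indep cover]
          induced_subdivision_eq_faces[OF fin _ indep cover] by simp
      moreover have "?\<beta> \<in> coefficient_space n"
        using \<alpha> b by (auto simp: coefficient_space_def scaleR_fun_def e_def)
      ultimately have "?\<beta> \<in> ?K" by (simp add: secondary_cone_def)
      then have "?\<beta> - \<alpha> \<in> span ?K" using \<alpha>K by (intro span_diff span_base)
      then have "(1/\<epsilon>) *\<^sub>R (?\<beta> - \<alpha>) \<in> span ?K" by (rule span_scale)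
      then show ?case using elim by simp
    qed
    then show ?thesis
      using eventually_happens'[OF trivial_limit_at_right_real] by blast
  qed
  \<comment> \<open>Upper bound on the dimension: members of the cone vanish off the lattice
    points.\<close>
  have "?K \<subseteq> span (e ` ?A)"
  proof
    fix \<beta> assume "\<beta> \<in> ?K"
    then have "\<beta> = (\<Sum>b \<in> ?A. \<beta> b *\<^sub>R e b)"
      unfolding sum_e by (auto simp: secondary_cone_def coefficient_space_def fun_eq_iff)
    also have "\<dots> \<in> span (e ` ?A)"
      by (intro span_sum span_scale span_base) auto
    finally show "\<beta> \<in> span (e ` ?A)" .
  qed
  then have "span ?K = span (e ` ?A)"
    using e_span by (intro equalityI span_minimal subspace_span) auto
  then have "dim ?K = card (e ` ?A)"
    using ind real_vector.dim_eq_card by metis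
  then show ?thesis
    by (simp add: full_dimensional_def card_image[OF inj])
qed

section \<open>The staircase triangulation\<close>

definition pt :: "real \<Rightarrow> real \<Rightarrow> real \<Rightarrow> real^3" where
  "pt x y z = vector [x, y, z]"

lemma pt_nth [simp]: "pt x y z $ 1 = x" "pt x y z $ 2 = y" "pt x y z $ 3 = z"
  by (simp_all add: pt_def)

lemma pt_eq_iff: "pt x y z = a \<longleftrightarrow> x = a $ 1 \<and> y = a $ 2 \<and> z = a $ 3"
  by (auto simp: vec_eq_iff forall_3)

lemma pt_inject [simp]: "pt x y z = pt x' y' z' \<longleftrightarrow> x = x' \<and> y = y' \<and> z = z'"
  by (simp add: pt_eq_iff)

lemma pt_inner [simp]: "pt x y z \<bullet> u = x * u $ 1 + y * u $ 2 + z * u $ 3"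
  by (simp add: inner_vec_def sum_3)

lemma inner_pt [simp]: "u \<bullet> pt x y z = u $ 1 * x + u $ 2 * y + u $ 3 * z"
  by (simp add: inner_vec_def sum_3)

lemma pt_arith:
  "pt x y z + pt x' y' z' = pt (x + x') (y + y') (z + z')"
  "pt x y z - pt x' y' z' = pt (x - x') (y - y') (z - z')"
  "c *\<^sub>R pt x y z = pt (c * x) (c * y) (c * z)"
  "- pt x y z = pt (- x) (- y) (- z)"
  by (auto simp: vec_eq_iff forall_3)

lemma convex_combination_4:
  fixes S :: "'a::real_vector set"
  assumes "convex S" "a \<in> S" "b \<in> S" "c \<in> S" "d \<in> S"
    and "p \<ge> 0" "q \<ge> 0" "r \<ge> 0" "s \<ge> 0" "p + q + r + s = 1"
  shows "p *\<^sub>R a + q *\<^sub>R b + r *\<^sub>R c + s *\<^sub>R d \<in> S"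
proof -
  have "(\<Sum>i \<in> {0..<4::nat}. [p, q, r, s] ! i *\<^sub>R [a, b, c, d] ! i) \<in> S"
  proof (rule convex_sum)
    show "sum ((!) [p, q, r, s]) {0..<4} = 1"
      using assms by (simp add: numeral_eq_Suc)
    show "[p, q, r, s] ! i \<ge> 0" "[a, b, c, d] ! i \<in> S" if "i \<in> {0..<4}" for i
      using that assms by (auto simp: numeral_eq_Suc less_Suc_eq nth_Cons split: nat.splits)
  qed (use assms in auto)
  then show ?thesis by (simp add: numeral_eq_Suc)
qed

lemma Gamma_simplex_eq:
  assumes "n > 0"
  shows "Gamma_simplex n = {a. a $ 1 \<ge> 0 \<and> a $ 2 \<ge> 0 \<and> a $ 3 \<ge> 0 \<and> a $ 1 + a $ 2 + a $ 3 \<le> real n}"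
    (is "_ = ?G")
proof (intro equalityI subsetI)
  have "{0::real^3, axis 1 (real n), axis 2 (real n), axis 3 (real n)} \<subseteq> ?G"
    by (auto simp: axis_def)
  moreover have "convex ?G"
  proof -
    have "?G = {a. pt 1 0 0 \<bullet> a \<ge> 0} \<inter> {a. pt 0 1 0 \<bullet> a \<ge> 0} \<inter> {a. pt 0 0 1 \<bullet> a \<ge> 0}
        \<inter> {a. pt 1 1 1 \<bullet> a \<le> real n}"
      by auto
    then show ?thesis
      by (simp only:) (intro convex_Int convex_halfspace_ge convex_halfspace_le)
  qed
  ultimately show "a \<in> ?G" if "a \<in> Gamma_simplex n" for a
    using that hull_minimal[of _ ?G convex] unfolding Gamma_simplex_def by blast
next
  fix a assume a: "a \<in> ?G"
  let ?n = "real n"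
  have n: "?n > 0" using assms by simp
  have "(1 - (a $ 1 + a $ 2 + a $ 3) / ?n) *\<^sub>R 0 + (a $ 1 / ?n) *\<^sub>R axis 1 ?n + (a $ 2 / ?n) *\<^sub>R axis 2 ?n
      + (a $ 3 / ?n) *\<^sub>R axis 3 ?n \<in> Gamma_simplex n"
    unfolding Gamma_simplex_def
    using a n
    by (intro convex_combination_4 convex_convex_hull) (auto simp: hull_inc field_simps)
  also have "(1 - (a $ 1 + a $ 2 + a $ 3) / ?n) *\<^sub>R 0 + (a $ 1 / ?n) *\<^sub>R axis 1 ?n
      + (a $ 2 / ?n) *\<^sub>R axis 2 ?n + (a $ 3 / ?n) *\<^sub>R axis 3 ?n = a"
    using n by (auto simp: vec_eq_iff forall_3 axis_def)
  finally show "a \<in> Gamma_simplex n" .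
qed

lemma lattice_points_eq:
  assumes "n > 0"
  shows "lattice_points n = {pt (real x) (real y) (real z) | x y z. x + y + z \<le> n}"
proof (intro equalityI subsetI)
  fix a assume a: "a \<in> lattice_points n"
  have "\<exists>k. a $ i = real k" for i
  proof -
    have "a $ i \<ge> 0"
      using a assms exhaust_3[of i] by (auto simp: lattice_points_def Gamma_simplex_eq)
    moreover have "a $ i \<in> \<int>" using a by (simp add: lattice_points_def lattice_def)
    ultimately have "a $ i \<in> \<nat>" by (simp add: Nats_altdef2)
    then show ?thesis by (auto elim: Nats_cases)
  qed
  then obtain x y z where xyz: "a $ 1 = real x" "a $ 2 = real y" "a $ 3 = real z" by metis
  then have "a = pt (real x) (real y) (real z)" by (simp add: vec_eq_iff forall_3)
  moreover have "real x + real y + real z \<le> real n"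
    using a assms xyz by (simp add: lattice_points_def Gamma_simplex_eq)
  then have "x + y + z \<le> n" by linarith
  ultimately show "a \<in> {pt (real x) (real y) (real z) | x y z. x + y + z \<le> n}" by blast
next
  fix a assume "a \<in> {pt (real x) (real y) (real z) | x y z. x + y + z \<le> n}"
  then obtain x y z where "a = pt (real x) (real y) (real z)" "x + y + z \<le> n" by blast
  moreover from this(2) have "real x + real y + real z \<le> real n" by linarith
  ultimately show "a \<in> lattice_points n"
    using assms by (auto simp: lattice_points_def Gamma_simplex_eq lattice_def forall_3)
qed

lemma finite_lattice_points:
  assumes "n > 0"
  shows "finite (lattice_points n)"
proof -
  have "lattice_points n \<subseteq> (\<lambda>(x, y, z). pt (real x) (real y) (real z)) ` ({..n} \<times> {..n} \<times> {..n})"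
  proof
    fix a assume "a \<in> lattice_points n"
    then obtain x y z where "a = pt (real x) (real y) (real z)" "x + y + z \<le> n"
      unfolding lattice_points_eq[OF assms] by blast
    then show "a \<in> (\<lambda>(x, y, z). pt (real x) (real y) (real z)) ` ({..n} \<times> {..n} \<times> {..n})"
      by (intro image_eqI[of _ _ "(x, y, z)"]) auto
  qed
  then show ?thesis by (rule finite_subset) auto
qed

section \<open>Base triangles and the tetrahedra above them\<close>

text \<open>The pairs are the lattice points of the projection of the simplex along the third axis; the fibre
  over \<open>d\<close> is the column \<open>column_pt d 0, \<dots>, column_pt d (column_height n d)\<close>.  The vertices of a base
  triangle are listed in lexicographic order.\<close>

fun column_height :: "nat \<Rightarrow> nat \<times> nat \<Rightarrow> nat" where
  "column_height n (x, y) = n - x - y"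

fun column_pt :: "nat \<times> nat \<Rightarrow> nat \<Rightarrow> real^3" where
  "column_pt (x, y) z = pt (real x) (real y) (real z)"

inductive base_triangle :: "nat \<Rightarrow> nat \<times> nat \<Rightarrow> nat \<times> nat \<Rightarrow> nat \<times> nat \<Rightarrow> bool" for n where
  right: "x + y + 2 \<le> n \<Longrightarrow> base_triangle n (x, 0) (x + 1, y) (x + 1, y + 1)"
| left: "x + y + 1 \<le> n \<Longrightarrow> base_triangle n (x, y) (x, y + 1) (x + 1, n - x - 1)"

text \<open>The rule names say which column, in lexicographic order, carries the vertical edge.
  Earlier columns contribute their bottom point, later ones their top point.\<close>

inductive_set tetrahedra :: "nat \<Rightarrow> (real^3) set set" for n where
  third: "base_triangle n p q r \<Longrightarrow> z < column_height n r \<Longrightarrow>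
    {column_pt r z, column_pt r (z + 1), column_pt p 0, column_pt q 0} \<in> tetrahedra n"
| second: "base_triangle n p q r \<Longrightarrow> z < column_height n q \<Longrightarrow>
    {column_pt q z, column_pt q (z + 1), column_pt p 0, column_pt r (column_height n r)} \<in> tetrahedra n"
| first: "base_triangle n p q r \<Longrightarrow> z < column_height n p \<Longrightarrow>
    {column_pt p z, column_pt p (z + 1), column_pt q (column_height n q), column_pt r (column_height n r)}
      \<in> tetrahedra n"

lemma tetrahedra_subset_lattice_points:
  assumes "n > 0" "T \<in> tetrahedra n"
  shows "T \<subseteq> lattice_points n"
proof -
  have in_col: "column_pt p z \<in> lattice_points n" if "fst p + snd p \<le> n" "z \<le> column_height n p" for p z
    using that by (cases p) (auto simp: lattice_points_eq[OF assms(1)])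
  have base: "fst p + snd p \<le> n" "fst q + snd q \<le> n" "fst r + snd r \<le> n"
    if "base_triangle n p q r" for p q r
    using that by (cases; simp)+
  from assms(2) show ?thesis
  proof cases
    case (third p q r z)
    show ?thesis unfolding third(1) insert_subset
      using base[OF third(2)] third(3) by (intro conjI in_col empty_subsetI) simp_all
  next
    case (second p q r z)
    show ?thesis unfolding second(1) insert_subset
      using base[OF second(2)] second(3) by (intro conjI in_col empty_subsetI) simp_all
  next
    case (first p q r z)
    show ?thesis unfolding first(1) insert_subset
      using base[OF first(2)] first(3) by (intro conjI in_col empty_subsetI) simp_all
  qed
qed

lemma finite_tetrahedra:
  assumes "n > 0"
  shows "finite (tetrahedra n)"
proof (rule finite_subset)
  show "tetrahedra n \<subseteq> Pow (lattice_points n)"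
    using tetrahedra_subset_lattice_points[OF assms] by blast
qed (simp add: finite_lattice_points[OF assms])

lemma unimodular_simplex_measure:
  fixes a b c d :: "real^3"
  assumes dist: "distinct [a, b, c, d]"
    and det: "\<bar>det (vector [b - a, c - a, d - a] :: real^3^3)\<bar> = 1"
  shows "measure lebesgue (convex hull {a, b, c, d}) = 1/6"
proof -
  define f :: "3 \<Rightarrow> real^3" where "f i = (if i = 1 then b else if i = 2 then c else d)" for i
  have f: "f 1 = b" "f 2 = c" "f 3 = d" by (simp_all add: f_def)
  have bij: "bij_betw f UNIV ({a, b, c, d} - {a})"
  proof (rule bij_betw_imageI)
    have "x = y" if "f x = f y" for x y
      using exhaust_3[of x] exhaust_3[of y] that dist by (elim disjE) (auto simp: f)
    then show "inj f" by (rule injI)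
    show "f ` UNIV = {a, b, c, d} - {a}"
      unfolding UNIV_3 using dist by (auto simp: f)
  qed
  have "measure lborel (convex hull {a, b, c, d}) =
     \<bar>det (\<chi> i. \<chi> j. f j $ i - a $ i)\<bar> / fact CARD(3)"
    using distinct_card[OF dist] by (intro content_simplex[OF _ _ _ bij]) simp_all
  \<comment> \<open>The volume formula has the edge vectors as columns, whereas
    \<open>vector\<close> lists them as rows.\<close>
  also have "(\<chi> i. \<chi> j. f j $ i - a $ i) = transpose (vector [b - a, c - a, d - a] :: real^3^3)"
    by (auto simp: vec_eq_iff forall_3 transpose_def f)
  also have "\<bar>det \<dots>\<bar> = 1" using det by (simp add: det_transpose)
  finally have "measure lborel (convex hull {a, b, c, d}) = 1/6"
    by (simp add: fact_numeral)
  moreover have "convex hull {a, b, c, d} \<in> sets lborel"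
    by (simp add: finite_imp_compact_convex_hull borel_compact)
  ultimately show ?thesis by (simp add: measure_completion)
qed

text \<open>Dependent points would have a hull with empty interior, hence negligible. Affine
  independence of the cells thus follows from their volume.\<close>

lemma affine_independent_if_measure_pos:
  fixes C :: "(real^3) set"
  assumes "card C = 4" "measure lebesgue (convex hull C) > 0"
  shows "\<not> affine_dependent C"
proof
  assume "affine_dependent C"
  then have "interior (convex hull C) = {}"
    using assms(1) by (subst interior_convex_hull_eq_empty) auto
  then have "negligible (convex hull C)"
    by (simp add: negligible_convex_interior)
  then show False using assms(2) negligible_imp_measure0 by fastforce
qed

text \<open>One edge is the third unit vector, so the determinant is up to sign the planar one,
  \<open>D\<close>, of the projected base triangle, whatever the heights of the other two
  vertices.\<close>

lemma tetrahedra_unimodular: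
  assumes "T \<in> tetrahedra n"
  shows "card T = 4 \<and> measure lebesgue (convex hull T) = 1/6"
proof -
  define D :: "nat \<times> nat \<Rightarrow> nat \<times> nat \<Rightarrow> nat \<times> nat \<Rightarrow> real" where
    "D c d e = (real (fst d) - real (fst c)) * (real (snd e) - real (snd c))
        - (real (fst e) - real (fst c)) * (real (snd d) - real (snd c))" for c d e
  have D_perm: "D q p r = - D p q r" "D r p q = D p q r" for p q r
    by (simp_all add: D_def algebra_simps)
  have tri: "distinct [p, q, r]" "\<bar>D p q r\<bar> = 1" if "base_triangle n p q r" for p q r
    using that by (cases; simp add: D_def)+
  have "card {column_pt c z, column_pt c (z + 1), column_pt d v, column_pt e w} = 4 \<and>
     measure lebesgue (convex hull {column_pt c z, column_pt c (z + 1), column_pt d v, column_pt e w}) = 1/6"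
    if "distinct [c, d, e]" and "\<bar>D c d e\<bar> = 1"
    for c d e z v w
  proof -
    obtain c1 c2 d1 d2 e1 e2 where *: "c = (c1, c2)" "d = (d1, d2)" "e = (e1, e2)"
      by (metis surj_pair)
    have dist: "distinct [column_pt c z, column_pt c (z + 1), column_pt d v, column_pt e w]"
      using that(1) by (auto simp: *)
    moreover have "\<bar>det (vector [column_pt c (z + 1) - column_pt c z, column_pt d v - column_pt c z,
        column_pt e w - column_pt c z] :: real^3^3)\<bar> = 1"
      using that(2) by (simp add: det_3 * pt_arith D_def algebra_simps)
    ultimately show ?thesis
      using unimodular_simplex_measure[OF dist] distinct_card[OF dist] by simp
  qed
  note key = this
  from assms show ?thesis
  proof cases
    case (third p q r z)
    show ?thesis unfolding third(1) using tri[OF third(2)] D_perm(1)[of q p r] D_perm(2)[of r p q] by (intro key) auto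
  next
    case (second p q r z)
    show ?thesis unfolding second(1) using tri[OF second(2)] D_perm(1)[of q p r] D_perm(2)[of r p q] by (intro key) auto
  next
    case (first p q r z)
    show ?thesis unfolding first(1) using tri[OF first(2)] D_perm(1)[of q p r] D_perm(2)[of r p q] by (intro key) auto
  qed
qed

section \<open>Covering the simplex\<close>

lemma base_triangle_height:
  assumes "base_triangle n p q r" "d \<in> {p, q, r}"
  shows "real (column_height n d) = real n - real (fst d) - real (snd d)"
  using assms by cases (auto simp: of_nat_diff)

lemma column_pt_eq: "column_pt d z = pt (real (fst d)) (real (snd d)) (real z)"
  by (cases d) simp

text \<open>Locates \<open>v\<close> on a path of \<open>k\<close> steps of length \<open>s\<close>.
  Later \<open>s\<close> is a barycentric weight: a column of \<open>k\<close> unit steps enters a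
  slice scaled by its weight. The far end is reached with \<open>f = 1\<close> in the last
  step.\<close>

lemma step_interpolation:
  fixes v s :: real
  assumes "0 \<le> v" "v \<le> s * real k" "k > 0" "s \<ge> 0"
  shows "\<exists>j f. j < k \<and> 0 \<le> f \<and> f \<le> 1 \<and> v = s * (real j + f)"
proof (cases "s = 0")
  case True
  then show ?thesis using assms by (intro exI[of _ 0]) auto
next
  case False
  define w where "w = v / s"
  have w: "0 \<le> w" "w \<le> real k" "v = s * w"
    using assms False by (auto simp: w_def field_simps)
  show ?thesis
  proof (cases "w < real k")
    case True
    define j where "j = nat \<lfloor>w\<rfloor>"
    have "real j \<le> w" "w < real j + 1" using w by (auto simp: j_def)
    then show ?thesis using True w by (intro exI[of _ j] exI[of _ "w - real j"]) auto
  next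
    case False
    then show ?thesis using w assms by (intro exI[of _ "k - 1"] exI[of _ 1]) (auto simp: of_nat_diff)
  qed
qed

text \<open>The slice at \<open>x = x0 + s\<close> has length
  \<open>s * (n - x0 - 1) + (1 - s) * (n - x0)\<close>. Its lower stretch meets the fan from
  \<open>(x0, 0)\<close> to column \<open>x0 + 1\<close>, its upper stretch the fan from the top of
  column \<open>x0 + 1\<close> to column \<open>x0\<close>.\<close>

lemma base_triangles_cover:
  assumes "n > 0" "x \<ge> 0" "y \<ge> 0" "x + y \<le> real n"
  shows "\<exists>p q r (l1::real) l2 l3. base_triangle n p q r \<and> l1 \<ge> 0 \<and> l2 \<ge> 0 \<and> l3 \<ge> 0 \<and> l1 + l2 + l3 = 1 \<and>
    x = l1 * real (fst p) + l2 * real (fst q) + l3 * real (fst r) \<and> y = l1 * real (snd p) + l2 * real (snd q) + l3 * real (snd r)"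
proof -
  obtain x0 s where x0: "x0 < n" "0 \<le> s" "s \<le> 1" "x = real x0 + s"
    using step_interpolation[of x 1 n] assms by auto
  let ?k = "n - x0 - 1"
  have k: "real ?k = real n - real x0 - 1" using x0 by (simp add: of_nat_diff)
  show ?thesis
  proof (cases "y < s * real ?k")
    case True
    then have "?k > 0" using assms x0 by (cases "?k = 0") auto
    then obtain j f where j: "j < ?k" "0 \<le> f" "f \<le> 1" "y = s * (real j + f)"
      using step_interpolation[of y s ?k] True assms x0 by auto
    have "base_triangle n (x0, 0) (x0 + 1, j) (x0 + 1, j + 1)"
      using j(1) by (intro right) simp
    moreover have "s * (1 - f) \<ge> 0" "s * f \<ge> 0" using j x0 by auto
    moreover have "1 - s \<ge> 0" "(1 - s) + s * (1 - f) + s * f = 1"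
      "x = (1 - s) * real (fst (x0, 0)) + s * (1 - f) * real (fst (x0 + 1, j)) + s * f * real (fst (x0 + 1, j + 1))"
      "y = (1 - s) * real (snd (x0, 0::nat)) + s * (1 - f) * real (snd (x0 + 1, j)) + s * f * real (snd (x0 + 1, j + 1))"
      using x0 j by (simp_all add: algebra_simps)
    ultimately show ?thesis by blast
  next
    case False
    have "y - s * real ?k \<le> (1 - s) * real (n - x0)"
      using assms(4) x0 k by (simp add: of_nat_diff algebra_simps)
    moreover have "n - x0 > 0" using x0 by simp
    ultimately obtain j f where j: "j < n - x0" "0 \<le> f" "f \<le> 1"
        "y - s * real ?k = (1 - s) * (real j + f)"
      using step_interpolation[of "y - s * real ?k" "1 - s" "n - x0"] False x0 by auto
    have "base_triangle n (x0, j) (x0, j + 1) (x0 + 1, ?k)"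
      using j(1) by (intro left) simp
    moreover have "(1 - s) * (1 - f) \<ge> 0" "(1 - s) * f \<ge> 0" using j x0 by auto
    moreover have "s \<ge> 0" "(1 - s) * (1 - f) + (1 - s) * f + s = 1"
      "x = (1 - s) * (1 - f) * real (fst (x0, j)) + (1 - s) * f * real (fst (x0, j + 1)) + s * real (fst (x0 + 1, ?k))"
      "y = (1 - s) * (1 - f) * real (snd (x0, j)) + (1 - s) * f * real (snd (x0, j + 1)) + s * real (snd (x0 + 1, ?k))"
      using x0 j(4) by (simp_all add: algebra_simps)
    ultimately show ?thesis by blast
  qed
qed

text \<open>As the last coordinate increases, the columns over \<open>r\<close>, \<open>q\<close>, \<open>p\<close> are climbed one
  after the other.\<close>

lemma tetrahedra_cover:
  assumes "n > 0"
  shows "convex hull (lattice_points n) \<subseteq> (\<Union>T \<in> tetrahedra n. convex hull T)"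
proof
  fix a assume "a \<in> convex hull (lattice_points n)"
  then have "a \<in> Gamma_simplex n"
    using hull_minimal[of "lattice_points n" "Gamma_simplex n" convex]
    by (auto simp: lattice_points_def Gamma_simplex_def)
  moreover define x y z where "x = a $ 1" "y = a $ 2" "z = a $ 3"
  ultimately have xyz: "x \<ge> 0" "y \<ge> 0" "z \<ge> 0" "x + y + z \<le> real n" and a: "a = pt x y z"
    using assms by (auto simp: Gamma_simplex_eq vec_eq_iff forall_3)
  then have "x + y \<le> real n" by simp
  from base_triangles_cover[OF assms xyz(1,2) this]
  obtain p q r l1 l2 l3 where tri: "base_triangle n p q r"
    and l: "l1 \<ge> 0" "l2 \<ge> 0" "l3 \<ge> 0" "l1 + l2 + l3 = 1"
    and xy: "x = l1 * real (fst p) + l2 * real (fst q) + l3 * real (fst r)" "y = l1 * real (snd p) + l2 * real (snd q) + l3 * real (snd r)"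
    by blast
  let ?h = "\<lambda>d. real (column_height n d)"
  have h: "?h p = real n - real (fst p) - real (snd p)" "?h q = real n - real (fst q) - real (snd q)"
    "?h r = real n - real (fst r) - real (snd r)"
    using base_triangle_height[OF tri] by auto
  \<comment> \<open>Column height is affine on the triangle, so the climb has total length
    \<open>n - x - y\<close>.\<close>
  have "l1 * ?h p + l2 * ?h q + l3 * ?h r = (l1 + l2 + l3) * real n - x - y"
    unfolding h xy by (simp add: algebra_simps)
  then have z: "z \<le> l1 * ?h p + l2 * ?h q + l3 * ?h r" using xyz(4) l(4) by simp
  \<comment> \<open>The last stage of the climb includes its end, so no strict inequality shows its
    column nonempty there.\<close>
  have hp: "column_height n p > 0" using tri by cases auto
  have combine: "a \<in> convex hull {column_pt c j, column_pt c (j + 1), column_pt d v, column_pt e w}"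
    if "lc \<ge> 0" "ld \<ge> 0" "le \<ge> 0" "lc + ld + le = 1" "0 \<le> f" "f \<le> 1"
      "x = lc * real (fst c) + ld * real (fst d) + le * real (fst e)" "y = lc * real (snd c) + ld * real (snd d) + le * real (snd e)"
      "z = lc * (real j + f) + ld * real v + le * real w"
    for c d e :: "nat \<times> nat" and lc ld le f :: real and j v w :: nat
  proof -
    have "(lc * (1 - f)) *\<^sub>R column_pt c j + (lc * f) *\<^sub>R column_pt c (j + 1) + ld *\<^sub>R column_pt d v
        + le *\<^sub>R column_pt e w
      \<in> convex hull {column_pt c j, column_pt c (j + 1), column_pt d v, column_pt e w}"
      using that(1-6) by (intro convex_combination_4 convex_convex_hull) (auto simp: hull_inc mult_left_le_one_le algebra_simps)
    also have "(lc * (1 - f)) *\<^sub>R column_pt c j + (lc * f) *\<^sub>R column_pt c (j + 1) + ld *\<^sub>R column_pt d v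
        + le *\<^sub>R column_pt e w = a"
      unfolding a column_pt_eq pt_arith pt_inject that(7-9) by (simp add: algebra_simps)
    finally show ?thesis .
  qed
  consider (r) "z < l3 * ?h r" | (q) "l3 * ?h r \<le> z" "z < l3 * ?h r + l2 * ?h q"
    | (p) "l3 * ?h r + l2 * ?h q \<le> z" by linarith
  then show "a \<in> (\<Union>T \<in> tetrahedra n. convex hull T)"
  proof cases
    case r
    then have "column_height n r > 0" using xyz(3) by (cases "column_height n r = 0") auto
    then obtain j f where j: "j < column_height n r" "0 \<le> f" "f \<le> 1" "z = l3 * (real j + f)"
      using step_interpolation[of z l3 "column_height n r"] r xyz(3) l(3) by auto
    have "a \<in> convex hull {column_pt r j, column_pt r (j + 1), column_pt p 0, column_pt q 0}"
      using l xy j by (intro combine[of l3 l1 l2 f]) auto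
    then show ?thesis using third[OF tri j(1)] by blast
  next
    case q
    then have "column_height n q > 0" by (cases "column_height n q = 0") auto
    then obtain j f where j: "j < column_height n q" "0 \<le> f" "f \<le> 1" "z - l3 * ?h r = l2 * (real j + f)"
      using step_interpolation[of "z - l3 * ?h r" l2 "column_height n q"] q l(2) by auto
    have "a \<in> convex hull {column_pt q j, column_pt q (j + 1), column_pt p 0,
        column_pt r (column_height n r)}"
      using l xy j by (intro combine[of l2 l1 l3 f]) auto
    then show ?thesis using second[OF tri j(1)] by blast
  next
    case p
    then obtain j f where j: "j < column_height n p" "0 \<le> f" "f \<le> 1"
        "z - l3 * ?h r - l2 * ?h q = l1 * (real j + f)"
      using step_interpolation[of "z - l3 * ?h r - l2 * ?h q" l1 "column_height n p"] z l(1) hp by auto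
    have "a \<in> convex hull {column_pt p j, column_pt p (j + 1), column_pt q (column_height n q),
        column_pt r (column_height n r)}"
      using l xy j by (intro combine[of l1 l2 l3 f]) auto
    then show ?thesis using first[OF tri j(1)] by blast
  qed
qed

section \<open>Regularity of the staircase triangulation\<close>

text \<open>Both \<open>base_term\<close> and \<open>column_term\<close> are, on each column, strictly concave up to a linear tilt; the
  tilt grows with the column so fast that columns are climbed one at a time.  For large \<open>N\<close> the three
  summands of \<open>height\<close> are compared lexicographically.\<close>

definition base_term :: "nat \<Rightarrow> real \<Rightarrow> real \<Rightarrow> real" where
  "base_term n x y = (real n + 1) * x * y - y * (y - 1) / 2"

text \<open>\<open>n + 1\<close> times the number with digits \<open>x\<close>, \<open>y\<close> in
  base \<open>n + 1\<close>: on the columns, lexicographic order becomes numerical order with gaps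
  of at least \<open>n + 1\<close>.\<close>

definition column_offset :: "nat \<Rightarrow> real \<Rightarrow> real \<Rightarrow> real" where
  "column_offset n x y = (real n + 1)\<^sup>2 * x + (real n + 1) * y"

definition column_term :: "nat \<Rightarrow> real \<Rightarrow> real \<Rightarrow> real \<Rightarrow> real" where
  "column_term n x y z = column_offset n x y * z - z * (z - 1) / 2"

definition height :: "nat \<Rightarrow> real \<Rightarrow> real^3 \<Rightarrow> real" where
  "height n N a = (if a \<in> lattice_points n
     then - N\<^sup>2 * (a $ 1)\<^sup>2 + N * base_term n (a $ 1) (a $ 2) + column_term n (a $ 1) (a $ 2) (a $ 3)
     else 0)"

text \<open>No integer lies strictly between \<open>k\<close> and \<open>k + 1\<close>. A tilted
  concave term equals minus half this product, so it is maximal on exactly one unit segment.\<close>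

lemma consecutive_quadratic:
  fixes j k :: nat
  shows "(if j = k \<or> j = k + 1 then (real j - real k) * (real j - real k - 1) = 0
    else (real j - real k) * (real j - real k - 1) > 0)"
proof (cases "j = k \<or> j = k + 1")
  case False
  then have "real j - real k < 0 \<or> real j - real k - 1 > 0" by linarith
  then have "(real j - real k) * (real j - real k - 1) > 0"
    by (auto intro: mult_neg_neg mult_pos_pos)
  then show ?thesis using False by simp
qed auto

text \<open>The difference has the factor \<open>t - j\<close>, and \<open>t + j - 1\<close> stays
  below \<open>2 * \<Delta>\<close>: a steep slope overrides concavity, so the top of the column
  wins.\<close>

lemma steep_increasing:
  fixes j t k n :: nat
  assumes "j < t" "t \<le> n" "\<Delta> \<ge> real n + 1"
  shows "\<Delta> * real j - real j * (real j - 1) / 2 + real k * real j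
       < \<Delta> * real t - real t * (real t - 1) / 2 + real k * real t"
proof -
  have "(real t - real j) * (\<Delta> + real k - (real t + real j - 1) / 2) > 0"
    using assms by (intro mult_pos_pos) auto
  then show ?thesis by (simp add: field_simps)
qed

text \<open>After splitting off \<open>j\<close>, the slope \<open>\<Delta> + k\<close> is at most
  \<open>-1\<close>, so the bottom of the column wins.\<close>

lemma steep_decreasing:
  fixes j k n :: nat
  assumes "0 < j" "k \<le> n" "\<Delta> \<le> - (real n + 1)"
  shows "\<Delta> * real j - real j * (real j - 1) / 2 + real k * real j < 0"
proof -
  have "real j * (\<Delta> + real k - (real j - 1) / 2) < 0"
    using assms by (intro mult_pos_neg) auto
  then show ?thesis by (simp add: field_simps)
qed

text \<open>\<open>g1\<close> keeps only the columns \<open>x0\<close> and \<open>x0 + 1\<close>.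
  The coefficient of \<open>y\<close> in \<open>base_term\<close> grows by \<open>n + 1\<close>
  between them, so \<open>b2\<close> can flatten one column to a unit edge while the other stays
  steep and contributes only the apex.\<close>

lemma base_triangle_supported:
  assumes "base_triangle n p q r"
  shows "\<exists>a1 c1 a2 b2 c2. \<forall>x y. x + y \<le> n \<longrightarrow>
    (let g1 = - (real x)\<^sup>2 + a1 * real x + c1;
         g2 = base_term n (real x) (real y) + a2 * real x + b2 * real y + c2
     in if (x, y) \<in> {p, q, r} then g1 = 0 \<and> g2 = 0 else g1 < 0 \<or> g1 = 0 \<and> g2 < 0)"
  using assms
proof cases
  case (right x0 y0)
  let ?D = "real n + 1"
  \<comment> \<open>The linear coefficient in \<open>y\<close> becomes \<open>y0\<close> in column
    \<open>x0 + 1\<close> and \<open>y0 - ?D\<close> in column \<open>x0\<close>; \<open>a2\<close>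
    then makes the maximum over the former zero.\<close>
  define b2 where "b2 = real y0 - ?D * (real x0 + 1)"
  define a2 where "a2 = - (real y0 * (real y0 + 1) / 2)"
  define g2 where "g2 x y = base_term n (real x) (real y) + a2 * real x + b2 * real y + (- a2 * real x0)"
    for x y :: nat
  have g1: "- (real x)\<^sup>2 + (2 * real x0 + 1) * real x + (- real x0 * (real x0 + 1))
      = - ((real x - real x0) * (real x - real x0 - 1))" for x
    by (simp add: power2_eq_square algebra_simps)
  have g2_0: "g2 x0 y = (- ?D) * real y - real y * (real y - 1) / 2 + real y0 * real y" for y
    by (simp add: g2_def base_term_def b2_def algebra_simps)
  have g2_1: "g2 (x0 + 1) y = - ((real y - real y0) * (real y - real y0 - 1)) / 2" for y
    by (simp add: g2_def base_term_def b2_def a2_def field_simps)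
  have "let g1 = - (real x)\<^sup>2 + (2 * real x0 + 1) * real x + (- real x0 * (real x0 + 1)); g2 = g2 x y
     in if (x, y) \<in> {p, q, r} then g1 = 0 \<and> g2 = 0 else g1 < 0 \<or> g1 = 0 \<and> g2 < 0" if "x + y \<le> n" for x y
  proof -
    consider "x = x0" | "x = x0 + 1" | "x \<noteq> x0 \<and> x \<noteq> x0 + 1" by blast
    then show ?thesis
    proof cases
      case 1
      have "y > 0 \<Longrightarrow> g2 x0 y < 0"
        unfolding g2_0 using right(4) by (intro steep_decreasing) auto
      then show ?thesis using 1 unfolding Let_def g1 right by (auto simp: g2_0)
    next
      case 2
      then show ?thesis using consecutive_quadratic[of y y0] unfolding Let_def g1 right
        by (auto simp: g2_1[simplified] split: if_splits)
    next
      case 3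
      then show ?thesis using consecutive_quadratic[of x x0] unfolding Let_def g1 right
        by (auto split: if_splits)
    qed
  qed
  then show ?thesis unfolding g2_def by blast
next
  case (left x0 y0)
  let ?D = "real n + 1"
  let ?e = "n - x0 - 1"
  define b2 where "b2 = real y0 - ?D * real x0"
  \<comment> \<open>\<open>f\<close> is the profile of the steep column \<open>x0 + 1\<close>,
    maximal at its top \<open>?e\<close>; \<open>c\<close> and \<open>a2\<close> bring the maxima of
    both columns to zero.\<close>
  define f where "f y = ?D * real y - real y * (real y - 1) / 2 + real y0 * real y" for y
  define c where "c = - (real y0 * (real y0 + 1) / 2)"
  define a2 where "a2 = - f ?e - c"
  define g2 where "g2 x y = base_term n (real x) (real y) + a2 * real x + b2 * real y + (c - a2 * real x0)"
    for x y :: nat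
  have g1: "- (real x)\<^sup>2 + (2 * real x0 + 1) * real x + (- real x0 * (real x0 + 1))
      = - ((real x - real x0) * (real x - real x0 - 1))" for x
    by (simp add: power2_eq_square algebra_simps)
  have g2_0: "g2 x0 y = - ((real y - real y0) * (real y - real y0 - 1)) / 2" for y
    by (simp add: g2_def base_term_def b2_def c_def field_simps)
  have g2_1: "g2 (x0 + 1) y = f y - f ?e" for y
    by (simp add: g2_def base_term_def b2_def a2_def f_def[of y] algebra_simps)
  have "let g1 = - (real x)\<^sup>2 + (2 * real x0 + 1) * real x + (- real x0 * (real x0 + 1)); g2 = g2 x y
     in if (x, y) \<in> {p, q, r} then g1 = 0 \<and> g2 = 0 else g1 < 0 \<or> g1 = 0 \<and> g2 < 0" if "x + y \<le> n" for x y
  proof -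
    consider "x = x0" | "x = x0 + 1" | "x \<noteq> x0 \<and> x \<noteq> x0 + 1" by blast
    then show ?thesis
    proof cases
      case 1
      then show ?thesis using consecutive_quadratic[of y y0] unfolding Let_def g1 left
        by (auto simp: g2_0 split: if_splits)
    next
      case 2
      have "y < ?e \<Longrightarrow> f y < f ?e"
        unfolding f_def by (rule steep_increasing[of _ _ n]) auto
      moreover have "y < ?e \<or> y = ?e" using that 2 by linarith
      ultimately show ?thesis using 2 unfolding Let_def g1 left
        by (auto simp: g2_1[simplified])
    next
      case 3
      then show ?thesis using consecutive_quadratic[of x x0] unfolding Let_def g1 left
        by (auto split: if_splits)
    qed
  qed
  then show ?thesis unfolding g2_def by blast
qed

text \<open>Two vertices are vertically adjacent and give \<open>b\<close>; the third is one column
  away and gives \<open>a\<close>.\<close>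

lemma base_triangle_affine:
  assumes "base_triangle n p q r"
  shows "\<exists>a b c. \<forall>d \<in> {p, q, r}. a * real (fst d) + b * real (snd d) + c = g d"
  using assms
proof cases
  case (right x y)
  let ?b = "g r - g q"
  let ?a = "g q - g p - real y * ?b"
  show ?thesis unfolding right(1-3)
    by (rule exI[of _ ?a], rule exI[of _ ?b], rule exI[of _ "g p - ?a * real x"])
       (simp add: right algebra_simps)
next
  case (left x y)
  let ?b = "g q - g p"
  let ?a = "g r - g p - (real (n - x - 1) - real y) * ?b"
  show ?thesis unfolding left(1-3)
    by (rule exI[of _ ?a], rule exI[of _ ?b], rule exI[of _ "g p - ?a * real x - ?b * real y"])
       (simp add: left algebra_simps)
qed

text \<open>Within a column a step adds exactly \<open>n + 1\<close>. Passing to the next column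
  gains \<open>(n + 1)\<^sup>2\<close>, and descending from \<open>y\<close> to \<open>e\<close>
  loses at most \<open>n * (n + 1)\<close> of it.\<close>

lemma base_triangle_offsets:
  assumes "base_triangle n p q r"
  shows "column_offset n (fst p) (snd p) + (real n + 1) \<le> column_offset n (fst q) (snd q)"
    and "column_offset n (fst q) (snd q) + (real n + 1) \<le> column_offset n (fst r) (snd r)"
proof -
  let ?D = "real n + 1"
  have base_step: "column_offset n (real x) (real y) + ?D = column_offset n (real x) (real (y + 1))" for x y
    by (simp add: column_offset_def distrib_left)
  have next_column: "column_offset n (real x) (real y) + ?D \<le> column_offset n (real (x + 1)) (real e)"
    if "y \<le> n + e" for x y e
  proof -
    have "?D * (real y + 1) \<le> ?D * (?D + real e)"
      using that by (intro mult_left_mono) auto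
    moreover have "column_offset n (real (x + 1)) (real e) = ?D\<^sup>2 * real x + ?D * (?D + real e)"
      by (simp add: column_offset_def power2_eq_square distrib_left)
    moreover have "column_offset n (real x) (real y) + ?D = ?D\<^sup>2 * real x + ?D * (real y + 1)"
      by (simp add: column_offset_def distrib_left)
    ultimately show ?thesis by linarith
  qed
  show "column_offset n (fst p) (snd p) + ?D \<le> column_offset n (fst q) (snd q)"
    using assms
  proof cases
    case (right x y)
    show ?thesis unfolding right(1,2) fst_conv snd_conv by (rule next_column) simp
  next
    case (left x y)
    show ?thesis unfolding left(1,2) fst_conv snd_conv by (rule eq_refl[OF base_step])
  qed
  show "column_offset n (fst q) (snd q) + ?D \<le> column_offset n (fst r) (snd r)"
    using assms
  proof cases
    case (right x y)
    show ?thesis unfolding right(2,3) fst_conv snd_conv by (rule eq_refl[OF base_step])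
  next
    case (left x y)
    show ?thesis unfolding left(2,3) fst_conv snd_conv using left(4) by (intro next_column) simp
  qed
qed

text \<open>The offsets of the columns are so far apart that the column \<open>c\<close> being climbed separates the
  columns already filled from those not yet begun.\<close>

lemma column_supported:
  assumes tri: "base_triangle n p q r" and c: "c \<in> {p, q, r}" "k < column_height n c"
    and target: "\<And>d. d \<in> {p, q, r} \<Longrightarrow> d \<noteq> c \<Longrightarrow>
       column_offset n (fst c) (snd c) + (real n + 1) \<le> column_offset n (fst d) (snd d) \<and> t d = column_height n d
     \<or> column_offset n (fst d) (snd d) + (real n + 1) \<le> column_offset n (fst c) (snd c) \<and> t d = 0"
  shows "\<exists>(a::real) b e s. \<forall>d \<in> {p, q, r}. \<forall>z \<le> column_height n d.
    (let g = column_term n (real (fst d)) (real (snd d)) (real z) + a * real (fst d) + b * real (snd d) + e * real z + s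
     in if (if d = c then z \<in> {k, k + 1} else z = t d) then g = 0 else g < 0)"
proof -
  define o' where "o' d = column_offset n (fst d) (snd d)" for d :: "nat \<times> nat"
  \<comment> \<open>Profile of column \<open>d\<close> after a tilt that flattens column
    \<open>c\<close> onto the segment from \<open>k\<close> to \<open>k + 1\<close>. The affine part
    chosen next shifts each maximum to zero.\<close>
  define f where "f d z = (o' d - o' c) * real z - real z * (real z - 1) / 2 + real k * real z" for d z
  define t' where "t' d = (if d = c then k else t d)" for d
  obtain a b s where abs: "\<And>d. d \<in> {p, q, r} \<Longrightarrow> a * real (fst d) + b * real (snd d) + s = - f d (t' d)"
    using base_triangle_affine[OF tri, of "\<lambda>d. - f d (t' d)"] by blast
  have hn: "column_height n d \<le> n" for d by (cases d) simp
  have "let g = column_term n (real (fst d)) (real (snd d)) (real z) + a * real (fst d) + b * real (snd d) + (real k - o' c) * real z + s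
     in if (if d = c then z \<in> {k, k + 1} else z = t d) then g = 0 else g < 0"
    if d: "d \<in> {p, q, r}" and z: "z \<le> column_height n d" for d z
  proof -
    have g: "column_term n (real (fst d)) (real (snd d)) (real z) + a * real (fst d) + b * real (snd d) + (real k - o' c) * real z + s
        = f d z - f d (t' d)"
      using abs[OF d] by (simp add: column_term_def f_def o'_def algebra_simps)
    show ?thesis
    proof (cases "d = c")
      case True
      have "f c z - f c k = - ((real z - real k) * (real z - real k - 1)) / 2"
        by (simp add: f_def field_simps)
      then show ?thesis
        using True consecutive_quadratic[of z k] unfolding Let_def g by (auto simp: t'_def split: if_splits)
    next
      case False
      have "f d z < f d (t d)" if "z \<noteq> t d"
        using target[OF d False, folded o'_def]
      proof
        assume "o' c + (real n + 1) \<le> o' d \<and> t d = column_height n d"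
        then show ?thesis
          unfolding f_def using that z hn[of d] by (intro steep_increasing[of _ _ n]) auto
      next
        assume *: "o' d + (real n + 1) \<le> o' c \<and> t d = 0"
        have "f d z < 0"
          unfolding f_def using that c(2) hn[of c] * by (intro steep_decreasing[of _ _ n]) auto
        moreover have "f d (t d) = 0" using * by (simp add: f_def)
        ultimately show ?thesis by simp
      qed
      then show ?thesis using False unfolding Let_def g by (auto simp: t'_def)
    qed
  qed
  then show ?thesis
    by (intro exI[of _ a] exI[of _ b] exI[of _ "real k - o' c"] exI[of _ s] ballI allI impI)
qed

text \<open>Turns support in three lexicographic levels into ordinary support by a single height
  function.\<close>

lemma eventually_lex_negative:
  fixes g1 g2 g3 :: real
  assumes "g1 < 0 \<or> g1 = 0 \<and> (g2 < 0 \<or> g2 = 0 \<and> g3 < 0)"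
  shows "\<forall>\<^sub>F N in at_top. N\<^sup>2 * g1 + N * g2 + g3 < 0"
proof -
  consider "g1 < 0" | "g1 = 0" "g2 < 0" | "g1 = 0" "g2 = 0" "g3 < 0" using assms by blast
  then show ?thesis
  proof cases
    case 1
    show ?thesis
      using eventually_gt_at_top[of "max 1 ((\<bar>g2\<bar> + \<bar>g3\<bar>) / - g1)"]
    proof eventually_elim
      case (elim N)
      then have N: "N > 1" "N * g1 + \<bar>g2\<bar> + \<bar>g3\<bar> < 0" using 1 by (auto simp: field_simps)
      have "\<bar>g3\<bar> \<le> N * \<bar>g3\<bar>" using N by (simp add: mult_le_cancel_right1)
      moreover have "N * g2 \<le> N * \<bar>g2\<bar>" using N by (simp add: mult_left_mono)
      moreover have "N * (N * g1 + \<bar>g2\<bar> + \<bar>g3\<bar>) < 0" using N by (intro mult_pos_neg) auto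
      ultimately show ?case by (simp add: power2_eq_square algebra_simps)
    qed
  next
    case 2
    show ?thesis
      using eventually_gt_at_top[of "\<bar>g3\<bar> / - g2"] by eventually_elim (use 2 in \<open>auto simp: field_simps\<close>)
  qed auto
qed

section \<open>Combining base and columns\<close>

lemma column_pt_inject [simp]: "column_pt d z = column_pt d' z' \<longleftrightarrow> d = d' \<and> z = z'"
  by (cases d; cases d') auto

text \<open>A common form of the three kinds of tetrahedra: \<open>c\<close> is climbed from level
  \<open>k\<close>, and \<open>t\<close> fixes the level in the other columns. One support argument
  then serves all kinds.\<close>

lemma tetrahedra_columns:
  assumes "T \<in> tetrahedra n"
  shows "\<exists>p q r c k t. base_triangle n p q r \<and> c \<in> {p, q, r} \<and> k < column_height n c \<and>
     (\<forall>d \<in> {p, q, r}. d \<noteq> c \<longrightarrow>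
       column_offset n (fst c) (snd c) + (real n + 1) \<le> column_offset n (fst d) (snd d) \<and> t d = column_height n d
     \<or> column_offset n (fst d) (snd d) + (real n + 1) \<le> column_offset n (fst c) (snd c) \<and> t d = 0) \<and>
     (\<forall>d z. column_pt d z \<in> T \<longleftrightarrow> d \<in> {p, q, r} \<and> (if d = c then z \<in> {k, k + 1} else z = t d))"
proof -
  have dist: "p \<noteq> q" "p \<noteq> r" "q \<noteq> r" if "base_triangle n p q r" for p q r
    using that by (cases; simp)+
  from assms show ?thesis
  proof cases
    case (third p q r k)
    note off = base_triangle_offsets[OF third(2)] and d = dist[OF third(2)]
    have "\<forall>d z. column_pt d z \<in> T \<longleftrightarrow> d \<in> {p, q, r} \<and> (if d = r then z \<in> {k, k + 1} else z = 0)"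
      unfolding third(1) using d by auto
    moreover have "\<forall>d \<in> {p, q, r}. d \<noteq> r \<longrightarrow>
        column_offset n (fst d) (snd d) + (real n + 1) \<le> column_offset n (fst r) (snd r)"
      using off by auto
    ultimately show ?thesis
      using third(2,3) by (intro exI[of _ p] exI[of _ q] exI[of _ r] exI[of _ k] exI[of _ "\<lambda>_. 0"]) simp
  next
    case (second p q r k)
    note off = base_triangle_offsets[OF second(2)] and d = dist[OF second(2)]
    have "\<forall>d z. column_pt d z \<in> T \<longleftrightarrow>
        d \<in> {p, q, r} \<and> (if d = q then z \<in> {k, k + 1} else z = (if d = p then 0 else column_height n d))"
      unfolding second(1) using d by auto
    then show ?thesis
      using second(2,3) off d
      by (intro exI[of _ p] exI[of _ q] exI[of _ r] exI[of _ q] exI[of _ k]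
            exI[of _ "\<lambda>d. if d = p then 0 else column_height n d"]) auto
  next
    case (first p q r k)
    note off = base_triangle_offsets[OF first(2)] and d = dist[OF first(2)]
    have "\<forall>d z. column_pt d z \<in> T \<longleftrightarrow>
        d \<in> {p, q, r} \<and> (if d = p then z \<in> {k, k + 1} else z = column_height n d)"
      unfolding first(1) using d by auto
    moreover have "\<forall>d \<in> {p, q, r}. d \<noteq> p \<longrightarrow>
        column_offset n (fst p) (snd p) + (real n + 1) \<le> column_offset n (fst d) (snd d)"
      using off by auto
    ultimately show ?thesis
      using first(2,3)
      by (intro exI[of _ p] exI[of _ q] exI[of _ r] exI[of _ k] exI[of _ "column_height n"]) simp
  qed
qed

text \<open>\<open>g1\<close> and \<open>g2\<close> discard columns off the base triangle,
  \<open>g3\<close> selects the tetrahedron over it; a large \<open>N\<close> merges the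
  levels.\<close>

lemma tetrahedra_supported:
  assumes n: "n > 0" and T: "T \<in> tetrahedra n"
  shows "\<forall>\<^sub>F N in at_top. supported_cell (lattice_points n) (height n N) T"
proof -
  let ?A = "lattice_points n"
  obtain p q r c k t where tri: "base_triangle n p q r" and c: "c \<in> {p, q, r}" "k < column_height n c"
    and target: "\<forall>d \<in> {p, q, r}. d \<noteq> c \<longrightarrow>
       column_offset n (fst c) (snd c) + (real n + 1) \<le> column_offset n (fst d) (snd d) \<and> t d = column_height n d
     \<or> column_offset n (fst d) (snd d) + (real n + 1) \<le> column_offset n (fst c) (snd c) \<and> t d = 0"
    and memT: "\<forall>d z. column_pt d z \<in> T \<longleftrightarrow> d \<in> {p, q, r} \<and> (if d = c then z \<in> {k, k + 1} else z = t d)"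
    using tetrahedra_columns[OF T] by blast
  obtain a1 c1 a2 b2 c2 where base: "\<And>x y. x + y \<le> n \<Longrightarrow>
    (let g1 = - (real x)\<^sup>2 + a1 * real x + c1;
         g2 = base_term n (real x) (real y) + a2 * real x + b2 * real y + c2
     in if (x, y) \<in> {p, q, r} then g1 = 0 \<and> g2 = 0 else g1 < 0 \<or> g1 = 0 \<and> g2 < 0)"
    using base_triangle_supported[OF tri] by blast
  have "\<exists>(a::real) b e s. \<forall>d \<in> {p, q, r}. \<forall>z \<le> column_height n d.
    (let g = column_term n (real (fst d)) (real (snd d)) (real z) + a * real (fst d) + b * real (snd d) + e * real z + s
     in if (if d = c then z \<in> {k, k + 1} else z = t d) then g = 0 else g < 0)"
    by (rule column_supported[OF tri c, of t]) (rule target[rule_format])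
  then obtain a3 b3 e3 c3 where col: "\<And>d z. d \<in> {p, q, r} \<Longrightarrow> z \<le> column_height n d \<Longrightarrow>
    (let g = column_term n (real (fst d)) (real (snd d)) (real z) + a3 * real (fst d) + b3 * real (snd d) + e3 * real z + c3
     in if (if d = c then z \<in> {k, k + 1} else z = t d) then g = 0 else g < 0)"
    by blast
  define g1 where "g1 a = - (a $ 1)\<^sup>2 + a1 * a $ 1 + c1" for a :: "real^3"
  define g2 where "g2 a = base_term n (a $ 1) (a $ 2) + a2 * a $ 1 + b2 * a $ 2 + c2" for a :: "real^3"
  define g3 where "g3 a = column_term n (a $ 1) (a $ 2) (a $ 3) + a3 * a $ 1 + b3 * a $ 2 + e3 * a $ 3 + c3"
    for a :: "real^3"
  have lex: "if a \<in> T then g1 a = 0 \<and> g2 a = 0 \<and> g3 a = 0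
      else g1 a < 0 \<or> g1 a = 0 \<and> (g2 a < 0 \<or> g2 a = 0 \<and> g3 a < 0)" if aA: "a \<in> ?A" for a
  proof -
    obtain x y z where a: "a = pt (real x) (real y) (real z)" and xyz: "x + y + z \<le> n"
      using aA unfolding lattice_points_eq[OF n] by blast
    have memT': "a \<in> T \<longleftrightarrow> (x, y) \<in> {p, q, r} \<and> (if (x, y) = c then z \<in> {k, k + 1} else z = t (x, y))"
      using memT[rule_format, of "(x, y)" z] by (simp add: a)
    have b: "if (x, y) \<in> {p, q, r} then g1 a = 0 \<and> g2 a = 0 else g1 a < 0 \<or> g1 a = 0 \<and> g2 a < 0"
      using base[of x y] xyz by (simp add: Let_def g1_def g2_def a)
    show ?thesis
    proof (cases "(x, y) \<in> {p, q, r}")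
      case True
      have "z \<le> column_height n (x, y)" using xyz by simp
      from col[OF True this]
      have "if (if (x, y) = c then z \<in> {k, k + 1} else z = t (x, y)) then g3 a = 0 else g3 a < 0"
        by (simp add: Let_def g3_def a)
      then show ?thesis using True b memT' by presburger
    next
      case False
      then show ?thesis using b memT' by presburger
    qed
  qed
  have "\<forall>\<^sub>F N in at_top. N\<^sup>2 * g1 a + N * g2 a + g3 a < 0" if "a \<in> ?A - T" for a
    using lex[of a] that by (intro eventually_lex_negative) auto
  then have "\<forall>\<^sub>F N in at_top. \<forall>a \<in> ?A - T. N\<^sup>2 * g1 a + N * g2 a + g3 a < 0"
    using finite_lattice_points[OF n] by (intro eventually_ball_finite) auto
  then show ?thesis
  proof eventually_elim
    case (elim N)
    let ?u = "pt (N\<^sup>2 * a1 + N * a2 + a3) (N * b2 + b3) e3"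
    let ?c = "- (N\<^sup>2 * c1 + N * c2 + c3)"
    have val: "height n N a + a \<bullet> ?u = ?c + (N\<^sup>2 * g1 a + N * g2 a + g3 a)" if "a \<in> ?A" for a
      using that by (simp add: height_def g1_def g2_def g3_def algebra_simps)
    have TA: "T \<subseteq> ?A" by (rule tetrahedra_subset_lattice_points[OF n T])
    have "height n N a + a \<bullet> ?u = ?c" if "a \<in> T" for a
      using val[of a] lex[of a] that TA by auto
    moreover have "height n N a + a \<bullet> ?u < ?c" if "a \<in> ?A - T" for a
      using val[of a] elim that by auto
    ultimately show ?case unfolding supported_cell_def using TA by blast
  qed
qed

section \<open>The two-point family\<close>

text \<open>Both \<open>a\<close> and \<open>b\<close> maximize the pairing with \<open>w\<close>,
  so along \<open>w\<close> no monomial overtakes their tie.\<close>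

lemma tropical_surface_translate:
  assumes "finite (lattice_points n)"
    and ab: "a \<in> maximizers (lattice_points n) \<alpha> v" "b \<in> maximizers (lattice_points n) \<alpha> v" "a \<noteq> b"
    and w: "b \<bullet> w = a \<bullet> w" "\<And>p. p \<in> lattice_points n \<Longrightarrow> p \<bullet> w \<le> a \<bullet> w"
  shows "v + w \<in> tropical_surface n \<alpha>"
proof -
  let ?A = "lattice_points n"
  have A: "a \<in> ?A" "b \<in> ?A" using ab by (auto simp: maximizers_def)
  have eq: "\<alpha> b + b \<bullet> v = \<alpha> a + a \<bullet> v" using ab by (auto simp: maximizers_def intro: antisym)
  have le: "\<alpha> p + p \<bullet> v \<le> \<alpha> a + a \<bullet> v" if "p \<in> ?A" for p
    using that ab by (auto simp: maximizers_def)
  have "tropical_polynomial n \<alpha> (v + w) = \<alpha> a + a \<bullet> (v + w)"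
    unfolding tropical_polynomial_def
  proof (rule Max_eqI)
    fix y assume "y \<in> (\<lambda>p. \<alpha> p + p \<bullet> (v + w)) ` ?A"
    then obtain p where "p \<in> ?A" "y = \<alpha> p + p \<bullet> (v + w)" by blast
    then show "y \<le> \<alpha> a + a \<bullet> (v + w)"
      using le[of p] w(2)[of p] by (simp add: inner_add_right)
  qed (use assms A in auto)
  moreover from this have "tropical_polynomial n \<alpha> (v + w) = \<alpha> b + b \<bullet> (v + w)"
    using eq w(1) by (simp add: inner_add_right)
  ultimately show ?thesis
    unfolding tropical_surface_def using A ab(3) by force
qed

text \<open>For \<open>n > 0\<close> this is \<open>ABCD\<close>, spanned by the lowest unit segment
  of column \<open>(0, 0)\<close> and the tops of columns \<open>(0, 1)\<close> and
  \<open>(1, n - 1)\<close>. Its edge \<open>CD\<close> lies in the facet of coordinate sum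
  \<open>n\<close>.\<close>

definition exit_tetrahedron :: "nat \<Rightarrow> (real^3) set" where
  "exit_tetrahedron n = {pt 0 0 0, pt 0 0 1, pt 0 1 (real (n - 1)), pt 1 (real (n - 1)) 0}"

lemma exit_tetrahedron_in_tetrahedra:
  assumes "n > 0"
  shows "exit_tetrahedron n \<in> tetrahedra n"
proof -
  have "base_triangle n (0, 0) (0, 1) (1, n - 1)"
    using left[of 0 0 n] assms by simp
  from first[OF this, of 0] show ?thesis
    using assms by (simp add: exit_tetrahedron_def)
qed

text \<open>As \<open>omega 3 + omega 4\<close> is \<open>(1, 1, 0)\<close>, this has second vertex
  \<open>v\<close> and length parameter \<open>s\<close>. Only the first vertex moves with
  \<open>s\<close>.\<close>

definition family_line :: "real^3 \<Rightarrow> real \<Rightarrow> (real^3) set" where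
  "family_line v s = closed_segment (v + pt (- s) (- s) 0) v
     \<union> ray (v + pt (- s) (- s) 0) (omega 1) \<union> ray (v + pt (- s) (- s) 0) (omega 2)
     \<union> ray v (omega 3) \<union> ray v (omega 4)"

lemma omega_eq:
  "omega 1 = pt (-1) 0 0" "omega 2 = pt 0 (-1) 0" "omega 3 = pt 0 0 (-1)" "omega 4 = pt 1 1 1"
  by (simp_all add: omega_def vec_eq_iff forall_3 axis_def)

lemma tropical_line_family_line:
  assumes "s \<ge> 0"
  shows "tropical_line (family_line v s)"
  unfolding tropical_line_def family_line_def
  by (rule exI[of _ 1], rule exI[of _ 2], rule exI[of _ 3], rule exI[of _ 4],
      rule exI[of _ "v + pt (- s) (- s) 0"], rule exI[of _ v], rule exI[of _ s])
     (use assms in \<open>simp add: omega_eq pt_arith vec_eq_iff forall_3\<close>)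

text \<open>The bounded segment is enlarged to a ray, which still suffices to separate the lines and
  to place them on the surface.\<close>

lemma family_line_cases:
  assumes "x \<in> family_line v s" "s \<ge> 0"
  shows "\<exists>t \<ge> 0. x - v = pt (- t) (- t) 0 \<or> x - v = pt (- s - t) (- s) 0 \<or> x - v = pt (- s) (- s - t) 0
    \<or> x - v = pt 0 0 (- t) \<or> x - v = pt t t t"
proof -
  have "\<exists>t \<ge> 0. x - v = pt (- t) (- t) 0" if seg: "x \<in> closed_segment (v + pt (- s) (- s) 0) v"
  proof -
    obtain u where "0 \<le> u" "u \<le> 1" "x = (1 - u) *\<^sub>R (v + pt (- s) (- s) 0) + u *\<^sub>R v"
      using seg by (auto simp: closed_segment_def)
    then have "x - v = pt (- ((1 - u) * s)) (- ((1 - u) * s)) 0"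
      by (auto simp: vec_eq_iff forall_3 algebra_simps)
    moreover have "(1 - u) * s \<ge> 0" using \<open>u \<le> 1\<close> assms(2) by simp
    ultimately show ?thesis by blast
  qed
  then show ?thesis
    using assms(1) unfolding family_line_def ray_def omega_eq
    by (fastforce simp: pt_arith add.assoc)
qed

lemma inj_on_family_line: "inj_on (family_line v) {0..}"
proof (rule inj_onI)
  fix s s' :: real assume s: "s \<in> {0..}" "s' \<in> {0..}" and eq: "family_line v s = family_line v s'"
  \<comment> \<open>Relative to \<open>v\<close> the first coordinate is below the second, which on
    any member only the ray along \<open>omega 1\<close> allows; its second coordinate then reveals
    \<open>s\<close>.\<close>
  have "v + pt (- s - 1) (- s) 0 = (v + pt (- s) (- s) 0) + 1 *\<^sub>R omega 1"
    unfolding omega_eq by (simp add: pt_arith add.assoc)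
  then have "v + pt (- s - 1) (- s) 0 \<in> ray (v + pt (- s) (- s) 0) (omega 1)"
    unfolding ray_def using zero_le_one by blast
  then have "v + pt (- s - 1) (- s) 0 \<in> family_line v s"
    unfolding family_line_def by blast
  then have "v + pt (- s - 1) (- s) 0 \<in> family_line v s'" using eq by simp
  from family_line_cases[OF this] show "s = s'"
    using s by auto
qed

lemma family_line_subset:
  assumes n: "n > 0" and max: "exit_tetrahedron n \<subseteq> maximizers (lattice_points n) \<alpha> v" and s: "s \<ge> 0"
  shows "family_line v s \<subseteq> tropical_surface n \<alpha>"
proof
  let ?A = "lattice_points n"
  fix x assume "x \<in> family_line v s"
  then obtain t where t: "t \<ge> 0" and cases: "x - v = pt (- t) (- t) 0 \<or> x - v = pt (- s - t) (- s) 0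
      \<or> x - v = pt (- s) (- s - t) 0 \<or> x - v = pt 0 0 (- t) \<or> x - v = pt t t t"
    using family_line_cases s by blast
  have vert: "pt 0 0 0 \<in> maximizers ?A \<alpha> v" "pt 0 0 1 \<in> maximizers ?A \<alpha> v"
    "pt 0 1 (real (n - 1)) \<in> maximizers ?A \<alpha> v" "pt 1 (real (n - 1)) 0 \<in> maximizers ?A \<alpha> v"
    using max by (auto simp: exit_tetrahedron_def)
  have p: "p $ 1 \<ge> 0" "p $ 2 \<ge> 0" "p $ 3 \<ge> 0" "p $ 1 + p $ 2 + p $ 3 \<le> real n" if "p \<in> ?A" for p
    using that n by (auto simp: lattice_points_def Gamma_simplex_eq)
  \<comment> \<open>Covers the segment and the rays along \<open>omega 1\<close> and
    \<open>omega 2\<close> at once.\<close>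
  have horizontal: "v + pt (- a) (- b) 0 \<in> tropical_surface n \<alpha>" if "a \<ge> 0" "b \<ge> 0" for a b
  proof (rule tropical_surface_translate[OF finite_lattice_points[OF n] vert(1,2)])
    show "q \<bullet> pt (- a) (- b) 0 \<le> pt 0 0 0 \<bullet> pt (- a) (- b) 0" if "q \<in> ?A" for q
      using mult_nonneg_nonneg[OF p(1)[OF that] \<open>a \<ge> 0\<close>] mult_nonneg_nonneg[OF p(2)[OF that] \<open>b \<ge> 0\<close>]
      by simp
  qed simp_all
  have down: "v + pt 0 0 (- t) \<in> tropical_surface n \<alpha>"
    using t p
    by (intro tropical_surface_translate[OF finite_lattice_points[OF n] vert(1,4)]) auto
  have up: "v + pt t t t \<in> tropical_surface n \<alpha>"
  proof (rule tropical_surface_translate[OF finite_lattice_points[OF n] vert(3,4)])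
    show "q \<bullet> pt t t t \<le> pt 0 1 (real (n - 1)) \<bullet> pt t t t" if "q \<in> ?A" for q
      using mult_right_mono[OF p(4)[OF that] t] n by (simp add: of_nat_diff algebra_simps)
  qed (simp_all add: algebra_simps)
  have x: "x = v + (x - v)" by simp
  from cases show "x \<in> tropical_surface n \<alpha>"
    using horizontal[of t t] horizontal[of "s + t" s] horizontal[of s "s + t"] down up t s
    by (subst x) (elim disjE; simp)
qed

lemma two_point_family_exists:
  assumes "n > 0" "exit_tetrahedron n \<subseteq> maximizers (lattice_points n) \<alpha> v"
  shows "\<exists>\<L>. two_point_family \<L> \<and> (\<forall>L \<in> \<L>. L \<subseteq> tropical_surface n \<alpha>)"
proof (intro exI conjI)
  let ?F = "family_line v ` {0..}"
  have "infinite ?F"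
    using finite_imageD[OF _ inj_on_family_line] infinite_Ici by blast
  moreover have "v + t *\<^sub>R omega 3 \<in> family_line v s" if "t \<ge> 0" for s t
    using that unfolding family_line_def ray_def by blast
  then have "v + 0 *\<^sub>R omega 3 \<in> family_line v s \<and> v + 1 *\<^sub>R omega 3 \<in> family_line v s" for s
    using zero_le_one by blast
  moreover have "v + 0 *\<^sub>R omega 3 \<noteq> v + 1 *\<^sub>R omega 3"
    unfolding omega_eq by (simp add: vec_eq_iff forall_3)
  ultimately show "two_point_family ?F"
    unfolding two_point_family_def using tropical_line_family_line by blast
  show "\<forall>L \<in> ?F. L \<subseteq> tropical_surface n \<alpha>"
    using family_line_subset[OF assms] by auto
qed

theorem theorem9p2:
  fixes \<delta> :: nat
  assumes "\<delta> > 0"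
  shows "(\<exists>S. regular_subdivision \<delta> S \<and>
              secondary_cone \<delta> S \<in> secondary_fan \<delta> \<and>
              full_dimensional \<delta> (secondary_cone \<delta> S) \<and>
              (\<forall>\<alpha> \<in> secondary_cone \<delta> S.
                 smooth_surface \<delta> \<alpha> \<and>
                 (\<exists>\<L>. two_point_family \<L> \<and> (\<forall>L \<in> \<L>. L \<subseteq> tropical_surface \<delta> \<alpha>)))) \<and>
         (\<exists>\<alpha>. smooth_surface \<delta> \<alpha> \<and>
              infinite {L. tropical_line L \<and> L \<subseteq> tropical_surface \<delta> \<alpha>})"
proof -
  let ?A = "lattice_points \<delta>" and ?T = "tetrahedra \<delta>"
  have "\<forall>\<^sub>F N in at_top. \<forall>T \<in> ?T. supported_cell ?A (height \<delta> N) T"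
    using finite_tetrahedra[OF assms] tetrahedra_supported[OF assms]
    by (intro eventually_ball_finite) auto
  then obtain N where "\<forall>T \<in> ?T. supported_cell ?A (height \<delta> N) T"
    using eventually_happens'[OF trivial_limit_at_top_linorder] by blast
  then have supp: "\<And>T. T \<in> ?T \<Longrightarrow> supported_cell ?A (height \<delta> N) T" by blast
  define \<alpha>0 where "\<alpha>0 = height \<delta> N"
  define S where "S = induced_subdivision \<delta> \<alpha>0"
  have \<alpha>0: "\<alpha>0 \<in> coefficient_space \<delta>"
    by (simp add: \<alpha>0_def coefficient_space_def height_def)
  have unimod: "card T = 4" "measure lebesgue (convex hull T) = 1/6" "\<not> affine_dependent T" if "T \<in> ?T" for T
    using tetrahedra_unimodular[OF that] affine_independent_if_measure_pos[of T] by auto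
  have exit: "exit_tetrahedron \<delta> \<in> ?T" by (rule exit_tetrahedron_in_tetrahedra[OF assms])
  have fin: "finite ?A" "?A \<noteq> {}"
    using finite_lattice_points[OF assms] tetrahedra_subset_lattice_points[OF assms exit]
    by (auto simp: exit_tetrahedron_def)
  note cover = tetrahedra_cover[OF assms]
  have S: "S = {convex hull C | C. C \<noteq> {} \<and> (\<exists>T \<in> ?T. C \<subseteq> T)}"
    unfolding S_def \<alpha>0_def by (rule induced_subdivision_eq_faces[OF fin supp unimod(3) cover])
  have regular: "regular_subdivision \<delta> S"
    unfolding regular_subdivision_def S_def using \<alpha>0 by blast
  have full: "full_dimensional \<delta> (secondary_cone \<delta> S)"
    unfolding S_def \<alpha>0_def
    by (rule full_dimensional_secondary_cone[OF fin finite_tetrahedra[OF assms] supp unimod(3) cover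
          \<alpha>0[unfolded \<alpha>0_def]])
  \<comment> \<open>A maximal cell lies in the hull of some tetrahedron, which is itself a cell, so
    the two coincide.\<close>
  have elementary: "elementary_triangulation S"
    unfolding elementary_triangulation_def
  proof (intro ballI impI)
    fix Y assume "Y \<in> S" and maximal: "\<forall>T' \<in> S. \<not> Y \<subset> T'"
    then obtain C T where C: "Y = convex hull C" "T \<in> ?T" "C \<subseteq> T" using S by blast
    have "T \<noteq> {}" using unimod(1)[OF C(2)] by auto
    then have "convex hull T \<in> S" using C(2) S by blast
    then have "Y = convex hull T" using maximal C hull_mono[OF C(3), of convex] by blast
    moreover have "T \<subseteq> lattice"
      using tetrahedra_subset_lattice_points[OF assms C(2)] by (simp add: lattice_points_def)
    ultimately show "lattice_tetrahedron Y \<and> measure lebesgue Y = 1/6"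
      unfolding lattice_tetrahedron_def using unimod[OF C(2)] by blast
  qed
  have cone: "smooth_surface \<delta> \<alpha> \<and>
      (\<exists>\<L>. two_point_family \<L> \<and> (\<forall>L \<in> \<L>. L \<subseteq> tropical_surface \<delta> \<alpha>))"
    if \<alpha>: "\<alpha> \<in> secondary_cone \<delta> S" for \<alpha>
  proof
    show "smooth_surface \<delta> \<alpha>"
      using \<alpha> elementary by (simp add: smooth_surface_def secondary_cone_def)
    have "exit_tetrahedron \<delta> \<noteq> {}" by (simp add: exit_tetrahedron_def)
    \<comment> \<open>The subdivision alone provides \<open>v\<close>: the hull of
      \<open>ABCD\<close> is a cell for every \<open>\<alpha>\<close> in the cone, hence comes from
      maximizers at some point.\<close>
    then have "convex hull (exit_tetrahedron \<delta>) \<in> S" using exit S by blast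
    then have "convex hull (exit_tetrahedron \<delta>) \<in> induced_subdivision \<delta> \<alpha>"
      using \<alpha> by (simp add: secondary_cone_def)
    then obtain v where "convex hull (exit_tetrahedron \<delta>) = convex hull (maximizers ?A \<alpha> v)"
      unfolding induced_subdivision_eq_range[OF fin(1)] by blast
    then have "exit_tetrahedron \<delta> \<subseteq> maximizers ?A \<alpha> v"
      by (rule convex_hull_affine_independent_subset_maximizers[OF unimod(3)[OF exit]])
    then show "\<exists>\<L>. two_point_family \<L> \<and> (\<forall>L \<in> \<L>. L \<subseteq> tropical_surface \<delta> \<alpha>)"
      by (rule two_point_family_exists[OF assms])
  qed
  have "\<alpha>0 \<in> secondary_cone \<delta> S" using \<alpha>0 by (simp add: secondary_cone_def S_def)
  from cone[OF this] obtain \<L> where "smooth_surface \<delta> \<alpha>0" "two_point_family \<L>"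
    "\<forall>L \<in> \<L>. L \<subseteq> tropical_surface \<delta> \<alpha>0" by blast
  moreover from this have "\<L> \<subseteq> {L. tropical_line L \<and> L \<subseteq> tropical_surface \<delta> \<alpha>0}" "infinite \<L>"
    by (auto simp: two_point_family_def)
  ultimately have "smooth_surface \<delta> \<alpha>0 \<and>
      infinite {L. tropical_line L \<and> L \<subseteq> tropical_surface \<delta> \<alpha>0}"
    using finite_subset by blast
  moreover have "secondary_cone \<delta> S \<in> secondary_fan \<delta>"
    unfolding secondary_fan_def using regular by blast
  ultimately show ?thesis using regular full cone by blast
qed

end
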